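(* Let $(\boldsymbol V,\boldsymbol E)$, $o$, $\theta$, $W$ be as in the context and suppose that $(\boldsymbol V,\boldsymbol E)$ satisfies the large-scale regularity hypothesis stated in the context, with constants $d\ge 2$, $R_0\ge 1$, $\alpha_0\in[0,1/2)$. Suppose there exist $p,q\in(1,\infty]$ with $$\frac1p+\frac1q<\frac2d$$ such that $$\sup_{R\ge1}\|\theta\|_{p,B(R)}+\sup_{R\ge1}\|\theta^{-1}\|_{1,B(R)}+\sup_{R\ge1}\|\nu\|_{q,B(R)}<\infty .$$ Then for every $m\ge 2$ there exist $d'>d$ and a constant $C_1\in(0,\infty)$ such that for every $f:\boldsymbol V\to\mathbb R$, $$\|f\|_{\ell^2(\boldsymbol V,\theta)}^2\;\le\; C_1\,R_1^{m}\,\mathcal M\,\mathcal E(f)^{m/(m+2)}\,\|\eta^{m/2}f\|_{\ell^2(\boldsymbol V,\theta)}^{4/(m+2)},$$ where $R_1$ is the constant from part (ii) of the large-scale regularity hypothesis associated with $d'$, and $$\mathcal M:=\sup_{R\ge1}\Bigl(\|1\vee\theta\|_{p,B(R)}\cdot\|1\vee\nu\|_{q,B(R)}+\|1\vee\theta^{-1}\|_{1,B(R)}\Bigr).$$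
   Context: $(\boldsymbol V,\boldsymbol E)$ is an infinite, connected, locally finite graph with non-oriented edges; $x\sim y$ means $\{x,y\}\in\boldsymbol E$; $\mathrm{dist}(x,y)$ is the graph distance. Fix $o\in\boldsymbol V$ and put $\eta(y):=\max\{\mathrm{dist}(o,y),1\}$. $B(x,R):=\{y:\mathrm{dist}(x,y)\le\lfloor R\rfloor\}$ and $B(R):=B(o,R)$. Norms: for finite $A\subset\boldsymbol V$ and $1\le p<\infty$, $\|f\|_{p,A}:=\bigl(\frac1{|A|}\sum_{y\in A}|f(y)|^p\bigr)^{1/p}$ (normalized), $\|f\|_{\infty,A}:=\max_{A}|f|$; $\|f\|_{\ell^p(A)}:=(\sum_{y\in A}|f(y)|^p)^{1/p}$ (not normalized); $\|f\|_{\ell^p(\boldsymbol V,\theta)}:=(\sum_{y\in\boldsymbol V}|f(y)|^p\theta(y))^{1/p}$. $\theta:\boldsymbol V\to(0,\infty)$ is a positive reference measure. $W:\boldsymbol V\times\boldsymbol V\to[0,\infty)$ satisfies $W(x,y)=W(y,x)$, $W(x,y)>0$ whenever $x\sim y$, and $\mu(x):=\sum_{y\in \boldsymbol V}W(x,y)<\infty$ for all $x$. Set $\nu(x):=\sum_{y\sim x}W(x,y)^{-1}$ and $\mathcal E(f):=\frac12\sum_{x,y\in\boldsymbol V}W(x,y)(f(y)-f(x))^2\in[0,\infty]$. In products on the right-hand side of the inequality, $0\cdot\infty$ is read as $\infty$. Large-scale regularity hypothesis: there are constants $d\ge2$, $R_0\ge1$, $\alpha_0\in[0,1/2)$ such that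 (i) there are $c_{\rm reg},C_{\rm reg}\in(0,\infty)$ such that for all $R\ge R_0$, $R^{\alpha_0}\le r\le R$ and $x\in B(R)$: $c_{\rm reg}r^d\le|B(x,r)|\le C_{\rm reg}r^d$; (ii) for every $d'>d$ there is $R_1\ge R_0$ such that for every $1<\rho<d'$ and $\rho_*>\rho$ with $\frac{d'}{\rho_*}=\frac{d'}{\rho}-1$ there are $C_0,C_{\rm S}\in(0,\infty)$ and $\delta_{\rm S}\in[1,\infty)$ such that for all $R\ge R_1$, $x\in B(R)$, $C_0R^{\alpha_0}\le r\le R$ and all $f:\boldsymbol V\to\mathbb R$, $$\|f-(f)_{B(x,r)}\|_{\ell^{\rho_*}(B(x,r))}\le C_{\rm S}\,r^{1-d/d'}\Bigl(\sum_{y,z\in B(x,\delta_{\rm S}r),\,y\sim z}|f(y)-f(z)|^\rho\Bigr)^{1/\rho},$$ where $(f)_{B}:=\frac1{|B|}\sum_{y\in B}f(y)$. *)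

theory Defs
  imports "HOL-Analysis.Analysis"
begin

section \<open>Graphs\<close>

text \<open>
  Edges are unordered pairs: \<open>x \<sim> y\<close> iff \<open>{x, y}\<close> lies in the edge set. Loops (singleton
  edges) are not excluded.
\<close>

definition adj :: "'v set set \<Rightarrow> ('v \<times> 'v) set" where
  "adj E = {(x, y). {x, y} \<in> E}"

locale infinite_graph =
  fixes V :: "'v set" and E :: "'v set set"
  assumes edges: "\<And>e. e \<in> E \<Longrightarrow> \<exists>x\<in>V. \<exists>y\<in>V. e = {x, y}"
    and infinite_vertices: "infinite V"
    and connected_graph: "\<And>x y. x \<in> V \<Longrightarrow> y \<in> V \<Longrightarrow> (x, y) \<in> (adj E)\<^sup>*"
    and locally_finite: "\<And>x. x \<in> V \<Longrightarrow> finite {y. (x, y) \<in> adj E}"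

text \<open>
  Length of a shortest walk; meaningful for vertices joined by some walk, hence for any two
  vertices of a connected graph.
\<close>

definition gdist :: "'v set set \<Rightarrow> 'v \<Rightarrow> 'v \<Rightarrow> nat" where
  "gdist E x y = (LEAST n. (x, y) \<in> adj E ^^ n)"

definition gball :: "'v set \<Rightarrow> 'v set set \<Rightarrow> 'v \<Rightarrow> real \<Rightarrow> 'v set" where
  "gball V E x R = {y \<in> V. int (gdist E x y) \<le> \<lfloor>R\<rfloor>}"

definition eta :: "'v set set \<Rightarrow> 'v \<Rightarrow> 'v \<Rightarrow> nat" where
  "eta E v0 y = max (gdist E v0 y) 1"

section \<open>Norms and the Dirichlet form\<close>

definition mean :: "'v set \<Rightarrow> ('v \<Rightarrow> real) \<Rightarrow> real" where
  "mean A f = (\<Sum>y\<in>A. f y) / real (card A)"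

text \<open>\<open>avg_norm p A f\<close> is the normalized norm \<open>\<parallel>f\<parallel>\<^sub>p\<^sub>,\<^sub>A\<close>, for finite nonempty \<open>A\<close> and
  \<open>1 \<le> p \<le> \<infinity>\<close>.\<close>

definition avg_norm :: "ereal \<Rightarrow> 'v set \<Rightarrow> ('v \<Rightarrow> real) \<Rightarrow> real" where
  "avg_norm p A f =
     (if p = \<infinity> then Max ((\<lambda>y. \<bar>f y\<bar>) ` A)
      else mean A (\<lambda>y. \<bar>f y\<bar> powr real_of_ereal p) powr (1 / real_of_ereal p))"

definition lp_norm :: "real \<Rightarrow> 'v set \<Rightarrow> ('v \<Rightarrow> real) \<Rightarrow> real" where
  "lp_norm p A f = (\<Sum>y\<in>A. \<bar>f y\<bar> powr p) powr (1 / p)"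

text \<open>Real powers on \<open>[0, \<infinity>]\<close>, for exponents \<open>a > 0\<close>.\<close>

definition ennreal_powr :: "ennreal \<Rightarrow> real \<Rightarrow> ennreal" where
  "ennreal_powr x a = (if x = \<infinity> then \<infinity> else ennreal (enn2real x powr a))"

definition weighted_lp_norm :: "real \<Rightarrow> 'v set \<Rightarrow> ('v \<Rightarrow> real) \<Rightarrow> ('v \<Rightarrow> real) \<Rightarrow> ennreal" where
  "weighted_lp_norm p V \<theta> f =
     ennreal_powr (\<Sum>\<^sub>\<infinity>y\<in>V. ennreal (\<bar>f y\<bar> powr p * \<theta> y)) (1 / p)"

definition energy :: "'v set \<Rightarrow> ('v \<Rightarrow> 'v \<Rightarrow> real) \<Rightarrow> ('v \<Rightarrow> real) \<Rightarrow> ennreal" where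
  "energy V W f =
     ennreal (1/2) * (\<Sum>\<^sub>\<infinity>(x, y)\<in>V \<times> V. ennreal (W x y * (f y - f x)\<^sup>2))"

definition nu :: "'v set set \<Rightarrow> ('v \<Rightarrow> 'v \<Rightarrow> real) \<Rightarrow> 'v \<Rightarrow> real" where
  "nu E W x = (\<Sum>y | (x, y) \<in> adj E. inverse (W x y))"

text \<open>
  Product on \<open>[0, \<infinity>]\<close> with \<open>0 \<cdot> \<infinity> = \<infinity>\<close>, unlike the library's \<open>0 * \<infinity> = 0\<close>.
\<close>

definition top_mult :: "ennreal \<Rightarrow> ennreal \<Rightarrow> ennreal" (infixl "\<odot>" 70) where
  "a \<odot> b = (if a = \<infinity> \<or> b = \<infinity> then \<infinity> else a * b)"

section \<open>Reference measure and conductances\<close>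

locale conductance_graph = infinite_graph V E
  for V :: "'v set" and E :: "'v set set" +
  fixes v0 :: 'v and \<theta> :: "'v \<Rightarrow> real" and W :: "'v \<Rightarrow> 'v \<Rightarrow> real"
  assumes base_vertex: "v0 \<in> V"
    and theta_pos: "\<And>x. x \<in> V \<Longrightarrow> \<theta> x > 0"
    and W_nonneg: "\<And>x y. x \<in> V \<Longrightarrow> y \<in> V \<Longrightarrow> W x y \<ge> 0"
    and W_sym: "\<And>x y. x \<in> V \<Longrightarrow> y \<in> V \<Longrightarrow> W x y = W y x"
    and W_pos: "\<And>x y. (x, y) \<in> adj E \<Longrightarrow> W x y > 0"
    and W_summable: "\<And>x. x \<in> V \<Longrightarrow> (\<lambda>y. W x y) summable_on V"

section \<open>Large-scale regularity\<close>

definition volume_regular ::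
  "'v set \<Rightarrow> 'v set set \<Rightarrow> 'v \<Rightarrow> real \<Rightarrow> real \<Rightarrow> real \<Rightarrow> bool" where
  "volume_regular V E v0 d R\<^sub>0 \<alpha>\<^sub>0 \<longleftrightarrow>
     (\<exists>c\<^sub>r\<^sub>e\<^sub>g > 0. \<exists>C\<^sub>r\<^sub>e\<^sub>g > 0. \<forall>R r x.
        R\<^sub>0 \<le> R \<and> R powr \<alpha>\<^sub>0 \<le> r \<and> r \<le> R \<and> x \<in> gball V E v0 R \<longrightarrow>
        c\<^sub>r\<^sub>e\<^sub>g * r powr d \<le> real (card (gball V E x r)) \<and>
        real (card (gball V E x r)) \<le> C\<^sub>r\<^sub>e\<^sub>g * r powr d)"

definition sobolev_regular_from ::
  "'v set \<Rightarrow> 'v set set \<Rightarrow> 'v \<Rightarrow> real \<Rightarrow> real \<Rightarrow> real \<Rightarrow> real \<Rightarrow> bool" where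
  "sobolev_regular_from V E v0 d \<alpha>\<^sub>0 d' R\<^sub>1 \<longleftrightarrow>
     (\<forall>\<rho> \<rho>'. 1 < \<rho> \<and> \<rho> < d' \<and> \<rho> < \<rho>' \<and> d' / \<rho>' = d' / \<rho> - 1 \<longrightarrow>
       (\<exists>C\<^sub>0 > 0. \<exists>C\<^sub>S > 0. \<exists>\<delta>\<^sub>S \<ge> 1. \<forall>R r x. \<forall>f :: 'v \<Rightarrow> real.
          R\<^sub>1 \<le> R \<and> C\<^sub>0 * R powr \<alpha>\<^sub>0 \<le> r \<and> r \<le> R \<and> x \<in> gball V E v0 R \<longrightarrow>
          lp_norm \<rho>' (gball V E x r) (\<lambda>y. f y - mean (gball V E x r) f)
          \<le> C\<^sub>S * r powr (1 - d / d') *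
             (\<Sum>(y, z) | y \<in> gball V E x (\<delta>\<^sub>S * r) \<and> z \<in> gball V E x (\<delta>\<^sub>S * r) \<and> (y, z) \<in> adj E.
                \<bar>f y - f z\<bar> powr \<rho>) powr (1 / \<rho>)))"

text \<open>
  The threshold radius in the Sobolev part depends on \<open>d'\<close> and is referred to later, so it is
  carried as a function \<open>R\<^sub>1\<close> of \<open>d'\<close>.
\<close>

definition large_scale_regular ::
  "'v set \<Rightarrow> 'v set set \<Rightarrow> 'v \<Rightarrow> real \<Rightarrow> real \<Rightarrow> real \<Rightarrow> (real \<Rightarrow> real) \<Rightarrow> bool" where
  "large_scale_regular V E v0 d R\<^sub>0 \<alpha>\<^sub>0 R\<^sub>1 \<longleftrightarrow>
     volume_regular V E v0 d R\<^sub>0 \<alpha>\<^sub>0 \<and>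
     (\<forall>d' > d. R\<^sub>0 \<le> R\<^sub>1 d' \<and> sobolev_regular_from V E v0 d \<alpha>\<^sub>0 d' (R\<^sub>1 d'))"

section \<open>Moment conditions\<close>

definition moment_sum ::
  "'v set \<Rightarrow> 'v set set \<Rightarrow> 'v \<Rightarrow> ('v \<Rightarrow> real) \<Rightarrow> ('v \<Rightarrow> 'v \<Rightarrow> real) \<Rightarrow> ereal \<Rightarrow> ereal \<Rightarrow> ennreal"
where
  "moment_sum V E v0 \<theta> W p q =
     (SUP R\<in>{1::real..}. ennreal (avg_norm p (gball V E v0 R) \<theta>)) +
     (SUP R\<in>{1::real..}. ennreal (avg_norm 1 (gball V E v0 R) (\<lambda>y. inverse (\<theta> y)))) +
     (SUP R\<in>{1::real..}. ennreal (avg_norm q (gball V E v0 R) (nu E W)))"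

definition moment_const ::
  "'v set \<Rightarrow> 'v set set \<Rightarrow> 'v \<Rightarrow> ('v \<Rightarrow> real) \<Rightarrow> ('v \<Rightarrow> 'v \<Rightarrow> real) \<Rightarrow> ereal \<Rightarrow> ereal \<Rightarrow> ennreal"
where
  "moment_const V E v0 \<theta> W p q =
     (SUP R\<in>{1::real..}. ennreal (
        avg_norm p (gball V E v0 R) (\<lambda>y. max 1 (\<theta> y)) *
        avg_norm q (gball V E v0 R) (\<lambda>y. max 1 (nu E W y)) +
        avg_norm 1 (gball V E v0 R) (\<lambda>y. max 1 (inverse (\<theta> y)))))"

end

theory Submission
  imports Defs
begin

text \<open>
  For every large \<open>R\<close> one has \<open>\<parallel>f\<parallel>\<^sup>2 \<le> C (R\<^sup>2 \<E>(f) + R\<^bsup>-m\<^esup> \<parallel>\<eta>\<^bsup>m/2\<^esup> f\<parallel>\<^sup>2)\<close>, and the best choice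
  of \<open>R\<close> gives the theorem (if it falls below the threshold, then \<open>\<parallel>f\<parallel> \<le> \<parallel>\<eta>\<^bsup>m/2\<^esup> f\<parallel>\<close> suffices). The part
  of \<open>\<parallel>f\<parallel>\<^sup>2\<close> outside \<open>B(R)\<close> is at most \<open>R\<^bsup>-m\<^esup> \<parallel>\<eta>\<^bsup>m/2\<^esup> f\<parallel>\<^sup>2\<close>. Inside, Hoelder's inequality turns the Sobolev
  inequality with \<open>2/d' = 1/p + 1/q\<close> into a weighted Poincare inequality with constant of order
  \<open>R\<^sup>2\<close>. The mean of \<open>f\<close> that it subtracts is controlled on the annulus \<open>B(R) - B(\<kappa>R)\<close>, which
  carries a fixed proportion of the volume and on which \<open>\<eta> \<ge> \<kappa>R\<close>; averaging over the full ball
  would lose the decay \<open>R\<^bsup>-m\<^esup>\<close> when \<open>m > d\<close>. Infinite exponents are first lowered to finite ones,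
  so that \<open>d'\<close> is finite.
\<close>

section \<open>Elementary inequalities\<close>

text \<open>Young's inequality, applied to the summands after each family is divided by its sum.
  Writing the conjugate exponents as \<alpha> and 1 - \<alpha> avoids taking roots of the summands
  in the later applications.\<close>

lemma Holder_sum_powr:
  fixes a b :: "'a \<Rightarrow> real"
  assumes "0 < \<alpha>" "\<alpha> < 1" and nn: "\<And>i. i \<in> I \<Longrightarrow> 0 \<le> a i" "\<And>i. i \<in> I \<Longrightarrow> 0 \<le> b i"
  shows "(\<Sum>i\<in>I. a i powr \<alpha> * b i powr (1 - \<alpha>)) \<le> (\<Sum>i\<in>I. a i) powr \<alpha> * (\<Sum>i\<in>I. b i) powr (1 - \<alpha>)"
proof (cases "finite I \<and> sum a I > 0 \<and> sum b I > 0")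
  case False
  \<comment> \<open>Degenerate cases: a sum over an infinite index set is 0 by convention, and a
    vanishing finite sum of nonnegative terms forces every term to vanish, where \<open>powr\<close>
    gives 0.\<close>
  have "a i powr \<alpha> * b i powr (1 - \<alpha>) = 0" if "finite I" "i \<in> I" for i
  proof -
    have "sum a I = 0 \<or> sum b I = 0"
      using False that nn sum_nonneg[of I a] sum_nonneg[of I b] by force
    then show ?thesis
      using that nn sum_nonneg_eq_0_iff[of I a] sum_nonneg_eq_0_iff[of I b] by auto
  qed
  then have "(\<Sum>i\<in>I. a i powr \<alpha> * b i powr (1 - \<alpha>)) = 0"
    by (cases "finite I") (auto intro!: sum.neutral)
  then show ?thesis by simp
next
  case True
  define S T where "S = sum a I" and "T = sum b I"
  have pos: "S > 0" "T > 0" using True by (auto simp: S_def T_def)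
  have le: "a i powr \<alpha> * b i powr (1 - \<alpha>)
      \<le> S powr \<alpha> * T powr (1 - \<alpha>) * (\<alpha> * (a i / S) + (1 - \<alpha>) * (b i / T))" if "i \<in> I" for i
  proof (cases "a i = 0 \<or> b i = 0")
    case True
    then show ?thesis using nn that pos assms by (auto intro!: mult_nonneg_nonneg add_nonneg_nonneg)
  next
    case False
    then have "a i > 0" "b i > 0" using nn that by force+
    then have "(a i / S) powr \<alpha> * (b i / T) powr (1 - \<alpha>) \<le> \<alpha> * (a i / S) + (1 - \<alpha>) * (b i / T)"
      using pos assms by (intro Youngs_inequality_0) auto
    moreover have "(a i / S) powr \<alpha> * (b i / T) powr (1 - \<alpha>)
        = a i powr \<alpha> * b i powr (1 - \<alpha>) / (S powr \<alpha> * T powr (1 - \<alpha>))"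
      using pos \<open>a i > 0\<close> \<open>b i > 0\<close> by (simp add: powr_divide)
    ultimately show ?thesis
      using pos by (simp add: divide_le_eq mult.commute)
  qed
  have "(\<Sum>i\<in>I. a i powr \<alpha> * b i powr (1 - \<alpha>))
      \<le> (\<Sum>i\<in>I. S powr \<alpha> * T powr (1 - \<alpha>) * (\<alpha> * (a i / S) + (1 - \<alpha>) * (b i / T)))"
    by (intro sum_mono le)
  also have "\<dots> = S powr \<alpha> * T powr (1 - \<alpha>) * (\<alpha> * (S / S) + (1 - \<alpha>) * (T / T))"
    unfolding S_def T_def by (simp only: sum.distrib sum_distrib_left[symmetric] sum_divide_distrib[symmetric])
  also have "\<dots> = S powr \<alpha> * T powr (1 - \<alpha>)"
    using pos by simp
  finally show ?thesis by (simp add: S_def T_def)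
qed

text \<open>Each term is at most the whole sum, so q - 1 of the q factors of a term can be replaced
  by the sum.\<close>

lemma sum_powr_le_powr_sum:
  fixes a :: "'a \<Rightarrow> real"
  assumes "finite I" "q \<ge> 1" and nn: "\<And>i. i \<in> I \<Longrightarrow> 0 \<le> a i"
  shows "(\<Sum>i\<in>I. a i powr q) \<le> (\<Sum>i\<in>I. a i) powr q"
proof -
  have split: "x powr q = x * x powr (q - 1)" if "x \<ge> 0" for x :: real
    using that by (cases "x = 0") (auto simp: powr_mult_base)
  have "(\<Sum>i\<in>I. a i powr q) \<le> (\<Sum>i\<in>I. a i * sum a I powr (q - 1))"
    using assms by (intro sum_mono) (auto simp: split intro!: mult_left_mono powr_mono2 member_le_sum)
  also have "\<dots> = sum a I powr q"
    using nn by (simp add: split sum_nonneg sum_distrib_right)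
  finally show ?thesis .
qed

text \<open>The two terms of \<open>bound\<close> balance at R = (n / e) powr (1 / (m + 2)), where
  both equal the product on the right. The threshold \<open>r\<close> may exclude this radius; the
  hypothesis \<open>Xn\<close> covers that case and contributes \<open>r powr m\<close> to the
  constant.\<close>

lemma optimize_scale:
  fixes X e n C m r :: real
  assumes m: "m > 0" and r: "r \<ge> 1" and C: "C > 0" and e: "e \<ge> 0" and n: "n \<ge> 0" and Xn: "X \<le> n"
    and bound: "\<And>R. R \<ge> r \<Longrightarrow> X \<le> C * (R\<^sup>2 * e + R powr (- m) * n)"
  shows "X \<le> (2 * C + r powr m) * (e powr (m / (m + 2)) * n powr (2 / (m + 2)))"
proof -
  consider "n = 0" | "n > 0" "e = 0" | "n > 0" "e > 0" using n e by fastforce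
  then show ?thesis
  proof cases
    case 1
    then show ?thesis using Xn by simp
  next
    case 2
    \<comment> \<open>Without energy there is no optimal radius; letting R tend to infinity shows X
      \<le> 0.\<close>
    have "((\<lambda>R. C * (R powr (- m) * n)) \<longlongrightarrow> C * (0 * n)) at_top"
      using m by (intro tendsto_intros tendsto_neg_powr filterlim_ident) auto
    moreover have "\<forall>\<^sub>F R in at_top. X \<le> C * (R powr (- m) * n)"
      using eventually_ge_at_top[of r] by eventually_elim (use bound 2 in auto)
    ultimately have "X \<le> C * (0 * n)"
      by (intro tendsto_lowerbound) auto
    then show ?thesis using 2 by simp
  next
    case 3
    define R where "R = (n / e) powr (1 / (m + 2))"
    have Rpos: "R > 0" using 3 by (simp add: R_def)
    have R2: "R\<^sup>2 = n powr (2 / (m + 2)) / e powr (2 / (m + 2))"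
      using 3 Rpos by (simp add: R_def powr_powr powr_divide flip: powr_numeral)
    have e_split: "e = e powr (m / (m + 2)) * e powr (2 / (m + 2))"
      using 3 m by (simp flip: powr_add add_divide_distrib)
    have n_split: "n = n powr (m / (m + 2)) * n powr (2 / (m + 2))"
      using 3 m by (simp flip: powr_add add_divide_distrib)
    show ?thesis
    proof (cases "R \<ge> r")
      case True
      have "R\<^sup>2 * e = e powr (m / (m + 2)) * n powr (2 / (m + 2))"
        by (subst e_split) (use R2 3 in simp)
      moreover have "R powr (- m) * n = e powr (m / (m + 2)) * n powr (2 / (m + 2))"
      proof -
        have "R powr (- m) * n powr (m / (m + 2)) = e powr (m / (m + 2))"
          using 3 m by (simp add: R_def powr_powr powr_divide powr_minus)
        then show ?thesis by (subst n_split) (simp add: mult.assoc[symmetric])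
      qed
      ultimately have "X \<le> 2 * C * (e powr (m / (m + 2)) * n powr (2 / (m + 2)))"
        using bound[OF True] by simp
      also have "\<dots> \<le> (2 * C + r powr m) * (e powr (m / (m + 2)) * n powr (2 / (m + 2)))"
        by (intro mult_right_mono) auto
      finally show ?thesis .
    next
      \<comment> \<open>Below the threshold n is small relative to e: the part n powr (m / (m + 2))
        of n is at most r powr m times the same power of e, so X \<le> n is already good
        enough.\<close>
      case False
      have "R powr (m + 2) = n / e"
        using 3 m by (simp add: R_def powr_powr)
      then have n_eq: "n = R powr (m + 2) * e" using 3 by simp
      have "n powr (m / (m + 2)) = R powr m * e powr (m / (m + 2))"
        using 3 m by (subst n_eq) (simp add: powr_mult powr_powr)
      also have "\<dots> \<le> r powr m * e powr (m / (m + 2))"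
        using False Rpos m by (intro mult_right_mono powr_mono2) auto
      finally have "n powr (m / (m + 2)) * n powr (2 / (m + 2))
          \<le> r powr m * e powr (m / (m + 2)) * n powr (2 / (m + 2))"
        by (intro mult_right_mono) auto
      then have "X \<le> r powr m * e powr (m / (m + 2)) * n powr (2 / (m + 2))"
        using Xn n_split by simp
      also have "\<dots> \<le> (2 * C + r powr m) * (e powr (m / (m + 2)) * n powr (2 / (m + 2)))"
        using C by (simp add: mult.assoc) (intro mult_right_mono, auto)
      finally show ?thesis .
    qed
  qed
qed

section \<open>Infinite sums and moments in the extended reals\<close>

lemma infsum_ennreal_leI:
  fixes f :: "'a \<Rightarrow> ennreal"
  assumes "\<And>F. finite F \<Longrightarrow> F \<subseteq> A \<Longrightarrow> sum f F \<le> c"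
  shows "(\<Sum>\<^sub>\<infinity>x\<in>A. f x) \<le> c"
  using assms by (auto simp: nonneg_infsum_complete intro!: SUP_least)

lemma finite_sum_le_enn2real_infsum:
  fixes g :: "'a \<Rightarrow> real"
  assumes fin: "(\<Sum>\<^sub>\<infinity>x\<in>A. ennreal (g x)) < \<infinity>" and F: "finite F" "F \<subseteq> A"
    and nn: "\<And>x. x \<in> A \<Longrightarrow> 0 \<le> g x"
  shows "sum g F \<le> enn2real (\<Sum>\<^sub>\<infinity>x\<in>A. ennreal (g x))"
proof -
  have "ennreal (sum g F) = (\<Sum>x\<in>F. ennreal (g x))"
    using F nn by (subst sum_ennreal) auto
  also have "\<dots> \<le> (\<Sum>\<^sub>\<infinity>x\<in>A. ennreal (g x))"
    using F by (subst nonneg_infsum_complete) (auto intro!: SUP_upper)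
  also have "\<dots> = ennreal (enn2real (\<Sum>\<^sub>\<infinity>x\<in>A. ennreal (g x)))"
    using fin by simp
  finally show ?thesis
    by (simp add: ennreal_le_iff)
qed

lemma SUP_ennreal_finite_bound:
  fixes F :: "'a \<Rightarrow> real"
  assumes "(SUP x\<in>S. ennreal (F x)) < \<infinity>"
  obtains K where "K > 0" "\<And>x. x \<in> S \<Longrightarrow> F x \<le> K"
proof
  define s where "s = enn2real (SUP x\<in>S. ennreal (F x))"
  show "s + 1 > 0" by (simp add: s_def add_nonneg_pos)
  fix x assume "x \<in> S"
  then have "ennreal (F x) \<le> (SUP x\<in>S. ennreal (F x))" by (rule SUP_upper)
  also have "\<dots> = ennreal s" using assms by (simp add: s_def)
  finally show "F x \<le> s + 1" by (simp add: ennreal_le_iff s_def)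
qed

text \<open>Trades an exponent that may be infinite for a real one at a cost of at most \<epsilon>
  in its reciprocal. A real exponent is kept; a uniform bound controls every finite moment.\<close>

lemma finite_moment:
  fixes p :: ereal and A :: "'i \<Rightarrow> 'v set" and g :: "'v \<Rightarrow> real"
  assumes p: "1 < p" and \<epsilon>: "\<epsilon> > 0" and A: "\<And>i. i \<in> S \<Longrightarrow> finite (A i)"
    and sup: "(SUP i\<in>S. ennreal (avg_norm p (A i) g)) < \<infinity>"
  obtains p\<^sub>0 K where "p\<^sub>0 > 1" "1 / p\<^sub>0 \<le> real_of_ereal (1 / p) + \<epsilon>" "K > 0"
    "\<And>i. i \<in> S \<Longrightarrow> (\<Sum>y\<in>A i. \<bar>g y\<bar> powr p\<^sub>0) \<le> K * real (card (A i))"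
proof -
  obtain K where K: "K > 0" "\<And>i. i \<in> S \<Longrightarrow> avg_norm p (A i) g \<le> K"
    using sup by (rule SUP_ennreal_finite_bound) blast
  show ?thesis
  proof (cases p)
    case (real r)
    then have r: "r > 1" using p by simp
    have "(\<Sum>y\<in>A i. \<bar>g y\<bar> powr r) \<le> K powr r * real (card (A i))" if i: "i \<in> S" for i
    proof -
      have nn: "0 \<le> mean (A i) (\<lambda>y. \<bar>g y\<bar> powr r)"
        by (simp add: mean_def sum_nonneg)
      have "mean (A i) (\<lambda>y. \<bar>g y\<bar> powr r) powr (1 / r) \<le> K"
        using K(2)[OF i] real by (simp add: avg_norm_def)
      then have "(mean (A i) (\<lambda>y. \<bar>g y\<bar> powr r) powr (1 / r)) powr r \<le> K powr r"
        using r by (intro powr_mono2) auto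
      then have "mean (A i) (\<lambda>y. \<bar>g y\<bar> powr r) \<le> K powr r"
        using r nn by (simp add: powr_powr)
      then show ?thesis
        using A[OF i] by (cases "A i = {}") (auto simp: mean_def divide_le_eq card_gt_0_iff)
    qed
    moreover have "1 / r \<le> real_of_ereal (1 / p) + \<epsilon>"
      using real r \<epsilon> by (simp add: one_ereal_def)
    ultimately show ?thesis
      using that[of r "K powr r"] r K by auto
  next
    case PInf
    \<comment> \<open>The reciprocal of p is 0 here, so 1 / r \<le> \<epsilon> is what is required;
      the 2 ensures r > 1.\<close>
    define r where "r = max 2 (1 / \<epsilon>)"
    have r: "r > 1" by (simp add: r_def)
    have "1 / r \<le> \<epsilon>" using \<epsilon> by (simp add: r_def max_def field_simps)
    then have "1 / r \<le> real_of_ereal (1 / p) + \<epsilon>" using PInf by simp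
    moreover have "(\<Sum>y\<in>A i. \<bar>g y\<bar> powr r) \<le> K powr r * real (card (A i))" if i: "i \<in> S" for i
    proof -
      have "\<bar>g y\<bar> \<le> K" if "y \<in> A i" for y
      proof -
        have "\<bar>g y\<bar> \<le> Max ((\<lambda>y. \<bar>g y\<bar>) ` A i)"
          using that A[OF i] by (intro Max_ge) auto
        then show ?thesis using K(2)[OF i] PInf by (simp add: avg_norm_def)
      qed
      then have "(\<Sum>y\<in>A i. \<bar>g y\<bar> powr r) \<le> (\<Sum>y\<in>A i. K powr r)"
        using r by (intro sum_mono powr_mono2) auto
      then show ?thesis by (simp add: mult.commute)
    qed
    ultimately show ?thesis
      using that[of r "K powr r"] r K by auto
  next
    case MInf
    then show ?thesis using p by simp
  qed
qed

section \<open>Balls in the graph distance\<close>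

context infinite_graph
begin

lemma adj_in_V: "(x, y) \<in> adj E \<Longrightarrow> x \<in> V \<and> y \<in> V"
  using edges by (fastforce simp: adj_def doubleton_eq_iff)

lemma finite_adj: "finite {y. (x, y) \<in> adj E}"
proof (cases "x \<in> V")
  case False
  then have "{y. (x, y) \<in> adj E} = {}" using adj_in_V by blast
  then show ?thesis by simp
qed (rule locally_finite)

lemma finite_walks: "finite {y. (x, y) \<in> adj E ^^ n}"
proof (induction n)
  case (Suc n)
  have "{y. (x, y) \<in> adj E ^^ Suc n} = (\<Union>z\<in>{z. (x, z) \<in> adj E ^^ n}. {y. (z, y) \<in> adj E})"
    by auto
  then show ?case using Suc finite_adj by simp
qed simp

lemma gdist_walk:
  assumes "x \<in> V" "y \<in> V"
  shows "(x, y) \<in> adj E ^^ gdist E x y"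
  using connected_graph[OF assms] unfolding gdist_def
  by (auto dest!: rtrancl_imp_relpow intro: LeastI)

lemma finite_gball:
  assumes "x \<in> V"
  shows "finite (gball V E x R)"
proof (rule finite_subset)
  show "gball V E x R \<subseteq> (\<Union>k\<le>nat \<lfloor>R\<rfloor>. {y. (x, y) \<in> adj E ^^ k})"
    using gdist_walk[OF assms] by (fastforce simp: gball_def)
qed (simp add: finite_walks)

lemma centre_in_gball:
  assumes "x \<in> V" "R \<ge> 0"
  shows "x \<in> gball V E x R"
proof -
  have "gdist E x x = 0" unfolding gdist_def by (rule Least_eq_0) simp
  then show ?thesis using assms by (simp add: gball_def)
qed

lemma gball_subset: "gball V E x R \<subseteq> V"
  by (auto simp: gball_def)

text \<open>The source of decay: off a ball of radius R the weight \<open>eta\<close> is at least R,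
  so weighted sums there gain a negative power of R.\<close>

lemma eta_outside_gball:
  assumes "y \<in> V" "y \<notin> gball V E x R"
  shows "R \<le> real (eta E x y)"
proof -
  have "R < real (gdist E x y)" using assms by (auto simp: gball_def le_floor_iff)
  then show ?thesis by (simp add: eta_def)
qed

end

section \<open>Gradients and the Dirichlet energy\<close>

context conductance_graph
begin

text \<open>The factor 2 undoes the 1/2 in \<open>energy\<close>; like the energy itself, the sum
  runs over ordered pairs.\<close>

lemma energy_finite_sum_le:
  assumes fin: "energy V W f < \<infinity>" and P: "finite P" "P \<subseteq> V \<times> V"
  shows "(\<Sum>(y, z)\<in>P. W y z * (f y - f z)\<^sup>2) \<le> 2 * enn2real (energy V W f)"
proof -
  define S where "S = (\<Sum>\<^sub>\<infinity>a\<in>V \<times> V. ennreal (W (fst a) (snd a) * (f (snd a) - f (fst a))\<^sup>2))"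
  have energy: "energy V W f = ennreal (1/2) * S"
    by (simp add: energy_def S_def case_prod_unfold)
  have S_fin: "S < \<infinity>"
    using fin energy by (auto simp: ennreal_mult_less_top)
  have "(\<Sum>a\<in>P. W (fst a) (snd a) * (f (snd a) - f (fst a))\<^sup>2) \<le> enn2real S"
    unfolding S_def
    using S_fin[unfolded S_def] P by (rule finite_sum_le_enn2real_infsum) (auto simp: W_nonneg)
  moreover have "2 * enn2real (energy V W f) = enn2real S"
    by (simp add: energy enn2real_mult enn2real_ennreal del: ennreal_half)
  ultimately show ?thesis
    by (simp add: case_prod_unfold power2_commute)
qed

lemma sum_conductance_powr_le_nu:
  assumes q: "q \<ge> 1" and A: "finite A"
  shows "(\<Sum>(y, z) | y \<in> A \<and> z \<in> A \<and> (y, z) \<in> adj E. W y z powr (- q)) \<le> (\<Sum>y\<in>A. nu E W y powr q)"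
proof -
  have "(\<Sum>(y, z) | y \<in> A \<and> z \<in> A \<and> (y, z) \<in> adj E. W y z powr (- q))
      \<le> (\<Sum>(y, z)\<in>Sigma A (\<lambda>y. {z. (y, z) \<in> adj E}). W y z powr (- q))"
    using A finite_adj by (intro sum_mono2) auto
  also have "\<dots> = (\<Sum>y\<in>A. \<Sum>z | (y, z) \<in> adj E. inverse (W y z) powr q)"
    using A finite_adj W_pos by (subst sum.Sigma) (auto intro!: sum.cong simp: powr_minus inverse_powr)
  also have "\<dots> \<le> (\<Sum>y\<in>A. nu E W y powr q)"
    unfolding nu_def using q finite_adj W_pos
    by (intro sum_mono sum_powr_le_powr_sum) (auto simp: less_imp_le)
  finally show ?thesis .
qed

text \<open>Hoelder's inequality with exponents \<alpha> = q / (q + 1) = \<rho> / 2 and 1 -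
  \<alpha>, after splitting each gradient term into an energy part and a power of the resistance.
  Raising to 2 / \<rho> = 1 + 1 / q makes the energy appear linearly.\<close>

lemma gradient_norm_le_energy:
  assumes q: "q > 1" and A: "finite A" "A \<subseteq> V" and fin: "energy V W f < \<infinity>"
    and \<rho>: "\<rho> = 2 * q / (q + 1)"
  shows "((\<Sum>(y, z) | y \<in> A \<and> z \<in> A \<and> (y, z) \<in> adj E. \<bar>f y - f z\<bar> powr \<rho>) powr (1 / \<rho>))\<^sup>2
    \<le> 2 * enn2real (energy V W f) * (\<Sum>y\<in>A. nu E W y powr q) powr (1 / q)"
proof -
  define P where "P = {(y, z). y \<in> A \<and> z \<in> A \<and> (y, z) \<in> adj E}"
  define X where "X = (\<Sum>(y, z)\<in>P. W y z * (f y - f z)\<^sup>2)"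
  define Y where "Y = (\<Sum>(y, z)\<in>P. W y z powr (- q))"
  define \<alpha> where "\<alpha> = q / (q + 1)"
  have P: "finite P" "P \<subseteq> V \<times> V"
    using A by (auto simp: P_def intro: finite_subset[of _ "A \<times> A"])
  have \<alpha>: "0 < \<alpha>" "\<alpha> < 1" "1 - \<alpha> = 1 / (q + 1)"
    using q by (auto simp: \<alpha>_def field_simps)
  have \<rho>\<alpha>: "\<rho> = 2 * \<alpha>" "\<rho> > 0" using q by (auto simp: \<rho> \<alpha>_def)
  have WP: "W (fst a) (snd a) > 0" if "a \<in> P" for a
    using that W_pos by (auto simp: P_def)
  have XY: "0 \<le> X" "0 \<le> Y"
    using WP by (auto simp: X_def Y_def case_prod_unfold less_imp_le intro!: sum_nonneg)
  have summand: "\<bar>f y - f z\<bar> powr \<rho> = (W y z * (f y - f z)\<^sup>2) powr \<alpha> * (W y z powr (- q)) powr (1 - \<alpha>)"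
    if "(y, z) \<in> P" for y z
  proof -
    have "(f y - f z)\<^sup>2 = \<bar>f y - f z\<bar> powr 2" by simp
    then have "\<bar>f y - f z\<bar> powr \<rho> = ((f y - f z)\<^sup>2) powr \<alpha>"
      by (simp only: \<rho>\<alpha> powr_powr)
    \<comment> \<open>The powers of the conductance cancel because \<alpha> = q (1 -
      \<alpha>).\<close>
    moreover have "W y z powr \<alpha> * (W y z powr (- q)) powr (1 - \<alpha>) = 1"
      using WP[OF that] \<alpha> q by (simp add: powr_powr \<alpha>_def flip: powr_add)
    ultimately show ?thesis
      using WP[OF that] by (simp add: powr_mult)
  qed
  have "(\<Sum>(y, z)\<in>P. \<bar>f y - f z\<bar> powr \<rho>)
      = (\<Sum>a\<in>P. (W (fst a) (snd a) * (f (fst a) - f (snd a))\<^sup>2) powr \<alpha>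
          * (W (fst a) (snd a) powr (- q)) powr (1 - \<alpha>))"
    using summand by (intro sum.cong) (auto simp: case_prod_unfold)
  also have "\<dots> \<le> X powr \<alpha> * Y powr (1 - \<alpha>)"
    unfolding X_def Y_def case_prod_unfold
    using \<alpha> WP by (intro Holder_sum_powr) (auto simp: less_imp_le)
  finally have "((\<Sum>(y, z)\<in>P. \<bar>f y - f z\<bar> powr \<rho>) powr (1 / \<rho>))\<^sup>2
      \<le> ((X powr \<alpha> * Y powr (1 - \<alpha>)) powr (1 / \<rho>))\<^sup>2"
    using \<rho>\<alpha> by (intro power_mono powr_mono2) (auto intro: sum_nonneg)
  also have "\<dots> = (X powr \<alpha> * Y powr (1 - \<alpha>)) powr (2 / \<rho>)"
    by (simp add: powr_powr flip: powr_numeral)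
  also have "\<dots> = X * Y powr (1 / q)"
  proof -
    have ratio: "2 / \<rho> = (q + 1) / q" using q by (simp add: \<rho> field_simps)
    have "\<alpha> * (2 / \<rho>) = 1" "(1 - \<alpha>) * (2 / \<rho>) = 1 / q"
      unfolding \<alpha>(3) unfolding \<alpha>_def ratio using q by simp_all
    then show ?thesis using XY by (simp add: powr_mult powr_powr)
  qed
  also have "\<dots> \<le> 2 * enn2real (energy V W f) * (\<Sum>y\<in>A. nu E W y powr q) powr (1 / q)"
  proof (intro mult_mono powr_mono2)
    show "X \<le> 2 * enn2real (energy V W f)"
      unfolding X_def by (rule energy_finite_sum_le[OF fin P])
    show "Y \<le> (\<Sum>y\<in>A. nu E W y powr q)"
      using sum_conductance_powr_le_nu[of q A] q A by (simp add: Y_def P_def)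
  qed (use q XY in auto)
  finally show ?thesis by (simp add: P_def)
qed

end

section \<open>Weighted sums and oscillation\<close>

text \<open>Hoelder's inequality with p and its conjugate p / (p - 1); the latter is doubled because
  g enters squared.\<close>

lemma weighted_square_sum_le_lp_norm:
  fixes g \<theta> :: "'v \<Rightarrow> real"
  assumes p: "p > 1" and \<theta>: "\<And>y. y \<in> A \<Longrightarrow> 0 \<le> \<theta> y"
  shows "(\<Sum>y\<in>A. (g y)\<^sup>2 * \<theta> y)
    \<le> (\<Sum>y\<in>A. \<theta> y powr p) powr (1 / p) * (lp_norm (2 * p / (p - 1)) A g)\<^sup>2"
proof -
  define r where "r = 2 * p / (p - 1)"
  have r: "r * (1 - 1 / p) = 2" "r > 0" using p by (auto simp: r_def field_simps)
  then have r2: "2 / r = 1 - 1 / p" by (simp add: field_simps)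
  have "(\<Sum>y\<in>A. (g y)\<^sup>2 * \<theta> y)
      = (\<Sum>y\<in>A. (\<theta> y powr p) powr (1 / p) * (\<bar>g y\<bar> powr r) powr (1 - 1 / p))"
    using p \<theta> r by (intro sum.cong) (auto simp: powr_powr)
  also have "\<dots> \<le> (\<Sum>y\<in>A. \<theta> y powr p) powr (1 / p) * (\<Sum>y\<in>A. \<bar>g y\<bar> powr r) powr (1 - 1 / p)"
    using p by (intro Holder_sum_powr) auto
  also have "(\<Sum>y\<in>A. \<bar>g y\<bar> powr r) powr (1 - 1 / p) = (lp_norm r A g)\<^sup>2"
    by (simp add: lp_norm_def powr_powr r2 flip: powr_numeral)
  finally show ?thesis by (simp add: r_def)
qed

text \<open>Shows that radii proportional to R are admissible in the regularity hypothesis once R is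
  large.\<close>

lemma powr_le_linear:
  fixes \<alpha> \<kappa> :: real
  assumes "\<alpha> < 1" "\<kappa> > 0"
  obtains r where "r \<ge> 1" "\<And>R. R \<ge> r \<Longrightarrow> R powr \<alpha> \<le> \<kappa> * R"
proof
  define r where "r = max 1 ((1 / \<kappa>) powr (1 / (1 - \<alpha>)))"
  show "r \<ge> 1" by (simp add: r_def)
  fix R assume R: "R \<ge> r"
  then have "R \<ge> 1" by (simp add: r_def)
  have "1 / \<kappa> = ((1 / \<kappa>) powr (1 / (1 - \<alpha>))) powr (1 - \<alpha>)"
    using assms by (simp add: powr_powr)
  also have "\<dots> \<le> R powr (1 - \<alpha>)"
    using R assms by (intro powr_mono2) (auto simp: r_def)
  finally have "R powr \<alpha> * (1 / \<kappa>) \<le> R powr \<alpha> * R powr (1 - \<alpha>)"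
    by (rule mult_left_mono) simp
  also have "\<dots> = R" using \<open>R \<ge> 1\<close> by (simp flip: powr_add)
  finally show "R powr \<alpha> \<le> \<kappa> * R" using assms by (simp add: field_simps)
qed

text \<open>A function close to a constant c on B is controlled by its size on a sizeable part A of
  B: on A the constant is comparable to f, and the moments of \<theta> and its inverse carry this
  bound for c from A to B. In the application c is the mean over a ball and A an annulus.\<close>

lemma weighted_square_sum_le_oscillation:
  fixes f \<theta> :: "'v \<Rightarrow> real"
  assumes B: "finite B" "A \<subseteq> B" "A \<noteq> {}" and \<theta>: "\<And>y. y \<in> B \<Longrightarrow> 0 < \<theta> y"
    and L: "real (card B) \<le> L * real (card A)"
    and K: "(\<Sum>y\<in>B. \<theta> y) \<le> K * real (card B)"
    and K': "(\<Sum>y\<in>B. inverse (\<theta> y)) \<le> K' * real (card B)"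
  shows "(\<Sum>y\<in>B. (f y)\<^sup>2 * \<theta> y) \<le> (2 + 4 * K * K' * L\<^sup>2) *
    ((\<Sum>y\<in>B. (f y - c)\<^sup>2 * \<theta> y) + (\<Sum>y\<in>A. (f y)\<^sup>2 * \<theta> y))"
proof -
  define D where "D = (\<Sum>y\<in>B. (f y - c)\<^sup>2 * \<theta> y)"
  define N where "N = (\<Sum>y\<in>A. (f y)\<^sup>2 * \<theta> y)"
  define T where "T = (\<Sum>y\<in>B. inverse (\<theta> y))"
  define S where "S = (\<Sum>y\<in>B. \<theta> y)"
  define a b where "a = real (card A)" and "b = real (card B)"
  have fA: "finite A" using B finite_subset by blast
  then have a: "a > 0" using B by (simp add: a_def card_gt_0_iff)
  have b: "b > 0" using B by (auto simp: b_def card_gt_0_iff)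
  have D: "D \<ge> 0" and N: "N \<ge> 0" and T: "T \<ge> 0" and S: "S \<ge> 0"
    using \<theta> B by (auto simp: D_def N_def T_def S_def less_imp_le subset_iff intro!: sum_nonneg)
  \<comment> \<open>The signs of K and K' follow from their bounds, whose left-hand sides are
    nonnegative.\<close>
  have "0 \<le> K * b" "0 \<le> K' * b"
    using K K' S T by (simp_all add: S_def T_def b_def)
  then have K0: "K \<ge> 0" "K' \<ge> 0"
    using b by (simp_all add: zero_le_mult_iff)
  have sq: "x\<^sup>2 * t \<le> 2 * ((y\<^sup>2) * t) + 2 * ((x - y)\<^sup>2 * t)" if "t > 0" for x y t :: real
  proof -
    have "2 * y\<^sup>2 + 2 * (x - y)\<^sup>2 - x\<^sup>2 = (x - 2 * y)\<^sup>2"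
      by (simp add: power2_eq_square algebra_simps)
    then have "x\<^sup>2 \<le> 2 * y\<^sup>2 + 2 * (x - y)\<^sup>2"
      using zero_le_power2[of "x - 2 * y"] by linarith
    then have "x\<^sup>2 * t \<le> (2 * y\<^sup>2 + 2 * (x - y)\<^sup>2) * t"
      using that by (intro mult_right_mono) auto
    then show ?thesis by (simp add: algebra_simps)
  qed
  \<comment> \<open>The inverse weights control \<open>c\<close> on \<open>A\<close> by its weighted norm there, and there \<open>c\<close> is
    \<open>f\<close> up to the oscillation.\<close>
  have "(a * c)\<^sup>2 = (\<Sum>y\<in>A. sqrt (inverse (\<theta> y)) * (sqrt (\<theta> y) * c))\<^sup>2"
  proof -
    have "(\<Sum>y\<in>A. sqrt (inverse (\<theta> y)) * (sqrt (\<theta> y) * c)) = (\<Sum>y\<in>A. c)"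
    proof (intro sum.cong refl)
      fix y assume "y \<in> A"
      then have "\<theta> y > 0" using \<theta> B by blast
      then show "sqrt (inverse (\<theta> y)) * (sqrt (\<theta> y) * c) = c" by (simp add: real_sqrt_inverse)
    qed
    then show ?thesis by (simp add: a_def)
  qed
  also have "\<dots> \<le> (\<Sum>y\<in>A. (sqrt (inverse (\<theta> y)))\<^sup>2) * (\<Sum>y\<in>A. (sqrt (\<theta> y) * c)\<^sup>2)"
    by (rule Cauchy_Schwarz_ineq_sum)
  also have "\<dots> = (\<Sum>y\<in>A. inverse (\<theta> y)) * (\<Sum>y\<in>A. c\<^sup>2 * \<theta> y)"
    using \<theta> B by (intro arg_cong2[of _ _ _ _ "(*)"] sum.cong)
      (auto simp: power_mult_distrib subset_iff less_imp_le)
  also have "\<dots> \<le> T * (2 * N + 2 * D)"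
  proof (intro mult_mono)
    show "(\<Sum>y\<in>A. inverse (\<theta> y)) \<le> T"
      unfolding T_def using B \<theta> by (intro sum_mono2) (auto simp: less_imp_le)
    have "(\<Sum>y\<in>A. c\<^sup>2 * \<theta> y) \<le> (\<Sum>y\<in>A. 2 * ((f y)\<^sup>2 * \<theta> y) + 2 * ((c - f y)\<^sup>2 * \<theta> y))"
      using sq \<theta> B by (intro sum_mono) (auto simp: subset_iff)
    also have "\<dots> = 2 * N + 2 * (\<Sum>y\<in>A. (f y - c)\<^sup>2 * \<theta> y)"
      by (simp add: N_def sum.distrib sum_distrib_left power2_commute[of c])
    also have "\<dots> \<le> 2 * N + 2 * D"
      unfolding D_def using B \<theta> by (intro add_left_mono mult_left_mono sum_mono2)
        (auto simp: less_imp_le)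
    finally show "(\<Sum>y\<in>A. c\<^sup>2 * \<theta> y) \<le> 2 * N + 2 * D" .
  qed (use \<theta> B T in \<open>auto simp: subset_iff less_imp_le intro!: sum_nonneg\<close>)
  finally have c: "(a * c)\<^sup>2 \<le> T * (2 * N + 2 * D)" .
  \<comment> \<open>Multiplying by S turns c squared into the weighted norm of c on B. The two
    moment bounds produce b squared, which L compares with a squared, so that the volumes
    cancel.\<close>
  have "(a * c)\<^sup>2 * S \<le> T * (2 * N + 2 * D) * S"
    using c S by (intro mult_right_mono)
  also have "\<dots> = S * T * (2 * N + 2 * D)" by simp
  also have "\<dots> \<le> (K * b) * (K' * b) * (2 * N + 2 * D)"
    using K K' S T D N K0 b by (intro mult_right_mono mult_mono) (auto simp: S_def T_def b_def)
  also have "\<dots> = K * K' * (2 * N + 2 * D) * b\<^sup>2"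
    by (simp add: power2_eq_square)
  also have "\<dots> \<le> K * K' * (2 * N + 2 * D) * (L * a)\<^sup>2"
    using L D N K0 b by (intro mult_left_mono power_mono) (auto simp: a_def b_def)
  finally have "a\<^sup>2 * (c\<^sup>2 * S) \<le> a\<^sup>2 * (K * K' * L\<^sup>2 * (2 * N + 2 * D))"
    by (simp add: power_mult_distrib mult_ac)
  then have cS: "c\<^sup>2 * S \<le> K * K' * L\<^sup>2 * (2 * N + 2 * D)"
    using a by (simp add: mult_le_cancel_left_pos)
  have "(\<Sum>y\<in>B. (f y)\<^sup>2 * \<theta> y) \<le> (\<Sum>y\<in>B. 2 * (c\<^sup>2 * \<theta> y) + 2 * ((f y - c)\<^sup>2 * \<theta> y))"
    using sq \<theta> by (intro sum_mono) auto
  also have "\<dots> = 2 * (c\<^sup>2 * S) + 2 * D"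
    by (simp add: S_def D_def sum.distrib sum_distrib_left)
  also have "\<dots> \<le> 2 * (K * K' * L\<^sup>2 * (2 * N + 2 * D)) + 2 * (D + N)"
    using cS N by simp
  also have "\<dots> = (2 + 4 * K * K' * L\<^sup>2) * (D + N)"
    by (simp add: algebra_simps)
  finally show ?thesis by (simp add: D_def N_def)
qed

section \<open>Volume growth and annuli\<close>

lemma volume_regular_centred:
  assumes "volume_regular V E v\<^sub>0 d R\<^sub>0 \<alpha>\<^sub>0" "infinite_graph V E" "v\<^sub>0 \<in> V" "R\<^sub>0 \<ge> 1"
  obtains c C where "c > 0" "C > 0"
    "\<And>R r. R\<^sub>0 \<le> R \<Longrightarrow> R powr \<alpha>\<^sub>0 \<le> r \<Longrightarrow> r \<le> R \<Longrightarrow>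
      c * r powr d \<le> real (card (gball V E v\<^sub>0 r)) \<and> real (card (gball V E v\<^sub>0 r)) \<le> C * r powr d"
proof -
  interpret infinite_graph V E by fact
  have centre: "v\<^sub>0 \<in> gball V E v\<^sub>0 R" if "R \<ge> R\<^sub>0" for R
    using assms that by (intro centre_in_gball) auto
  obtain c C where cC: "c > 0" "C > 0" "\<forall>R r x. R\<^sub>0 \<le> R \<and> R powr \<alpha>\<^sub>0 \<le> r \<and> r \<le> R \<and> x \<in> gball V E v\<^sub>0 R \<longrightarrow>
        c * r powr d \<le> real (card (gball V E x r)) \<and> real (card (gball V E x r)) \<le> C * r powr d"
    using assms(1) unfolding volume_regular_def by blast
  show ?thesis
    by (rule that[OF cC(1,2)]) (use cC(3) centre in blast)
qed

text \<open>For small \<kappa> the upper volume bound at radius \<kappa> R is at most half the lower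
  bound at R, so the annulus keeps volume at least c / 2 * R powr d. Comparison with the upper bound
  at R gives L = 2 * C / c.\<close>

lemma annulus_volume:
  assumes "volume_regular V E v\<^sub>0 d R\<^sub>0 \<alpha>\<^sub>0" "infinite_graph V E" "v\<^sub>0 \<in> V" "R\<^sub>0 \<ge> 1"
    and "d > 0" "\<alpha>\<^sub>0 < 1"
  obtains \<kappa> L r where "0 < \<kappa>" "\<kappa> \<le> 1" "L > 0" "r \<ge> 1"
    "\<And>R. R \<ge> r \<Longrightarrow> real (card (gball V E v\<^sub>0 R))
      \<le> L * real (card (gball V E v\<^sub>0 R - gball V E v\<^sub>0 (\<kappa> * R)))"
proof -
  interpret infinite_graph V E by fact
  obtain c C where c: "c > 0" and C: "C > 0" and vol: "\<And>R r. R\<^sub>0 \<le> R \<Longrightarrow> R powr \<alpha>\<^sub>0 \<le> r \<Longrightarrow> r \<le> R \<Longrightarrow>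
      c * r powr d \<le> real (card (gball V E v\<^sub>0 r)) \<and> real (card (gball V E v\<^sub>0 r)) \<le> C * r powr d"
  proof -
    show thesis by (rule volume_regular_centred[OF assms(1-4)]) (fact that)
  qed
  define \<kappa> where "\<kappa> = min 1 ((c / (2 * C)) powr (1 / d))"
  have \<kappa>: "0 < \<kappa>" "\<kappa> \<le> 1" using c C by (auto simp: \<kappa>_def)
  have "\<kappa> powr d \<le> ((c / (2 * C)) powr (1 / d)) powr d"
    using \<kappa> assms by (intro powr_mono2) (auto simp: \<kappa>_def)
  then have \<kappa>d: "C * \<kappa> powr d \<le> c / 2"
    using assms c C by (simp add: powr_powr field_simps)
  \<comment> \<open>Since \<open>\<alpha>\<^sub>0 < 1\<close>, the radius \<kappa> R is admissible
    in the volume bounds for all large R.\<close>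
  obtain r' where r': "r' \<ge> 1" "\<And>R. R \<ge> r' \<Longrightarrow> R powr \<alpha>\<^sub>0 \<le> \<kappa> * R"
    using powr_le_linear[OF \<open>\<alpha>\<^sub>0 < 1\<close> \<kappa>(1)] by blast
  show ?thesis
  proof (rule that[OF \<kappa>, of "2 * C / c" "max R\<^sub>0 r'"])
    fix R assume R: "R \<ge> max R\<^sub>0 r'"
    then have R1: "R \<ge> 1" using r' by simp
    then have "\<kappa> * R \<le> R" using \<kappa> by simp
    then have small: "real (card (gball V E v\<^sub>0 (\<kappa> * R))) \<le> C * (\<kappa> * R) powr d"
      using vol[of R "\<kappa> * R"] r' R by auto
    also have "\<dots> \<le> c / 2 * R powr d"
      using mult_right_mono[OF \<kappa>d, of "R powr d"] \<kappa> R1 by (simp add: powr_mult mult.assoc)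
    finally have small: "real (card (gball V E v\<^sub>0 (\<kappa> * R))) \<le> c / 2 * R powr d" .
    have big: "c * R powr d \<le> real (card (gball V E v\<^sub>0 R))" "real (card (gball V E v\<^sub>0 R)) \<le> C * R powr d"
      using vol[of R R] r'(2)[of R] R \<open>\<kappa> * R \<le> R\<close> by auto
    have "card (gball V E v\<^sub>0 R) \<le> card (gball V E v\<^sub>0 (\<kappa> * R)) + card (gball V E v\<^sub>0 R - gball V E v\<^sub>0 (\<kappa> * R))"
      using finite_gball[OF \<open>v\<^sub>0 \<in> V\<close>]
      by (intro order_trans[OF card_mono card_Un_le]) auto
    then have "c / 2 * R powr d \<le> real (card (gball V E v\<^sub>0 R - gball V E v\<^sub>0 (\<kappa> * R)))"
      using small big by linarith
    then have "2 * C / c * (c / 2 * R powr d) \<le> 2 * C / c * real (card (gball V E v\<^sub>0 R - gball V E v\<^sub>0 (\<kappa> * R)))"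
      using c C by (intro mult_left_mono) auto
    then show "real (card (gball V E v\<^sub>0 R)) \<le> 2 * C / c * real (card (gball V E v\<^sub>0 R - gball V E v\<^sub>0 (\<kappa> * R)))"
      using big c by simp
  qed (use c C r' in auto)
qed

section \<open>Weighted Poincare inequality\<close>

context conductance_graph
begin

text \<open>Three inequalities are chained: Hoelder against \<theta>, Sobolev from \<rho> = 2q / (q
  + 1) to \<rho>' = 2p / (p - 1), and Hoelder against the conductances. The choice of d' makes
  \<rho> and \<rho>' Sobolev conjugate and also leaves exactly the power 2 of R.\<close>

lemma weighted_poincare:
  assumes reg: "volume_regular V E v0 d R\<^sub>0 \<alpha>\<^sub>0" "sobolev_regular_from V E v0 d \<alpha>\<^sub>0 d' R\<^sub>1"
    and d: "d > 0" "R\<^sub>0 \<ge> 1" "\<alpha>\<^sub>0 < 1" and pq: "p > 1" "q > 1"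
    and d': "d' = 2 / (1 / p + 1 / q)" "2 \<le> d'"
    and \<theta>p: "\<And>R. R \<ge> 1 \<Longrightarrow> (\<Sum>y\<in>gball V E v0 R. \<theta> y powr p) \<le> K\<^sub>p * real (card (gball V E v0 R))"
    and \<nu>q: "\<And>R. R \<ge> 1 \<Longrightarrow> (\<Sum>y\<in>gball V E v0 R. nu E W y powr q) \<le> K\<^sub>q * real (card (gball V E v0 R))"
    and K: "K\<^sub>p > 0" "K\<^sub>q > 0"
  obtains C r where "C > 0" "r \<ge> 1"
    "\<And>R f. R \<ge> r \<Longrightarrow> energy V W f < \<infinity> \<Longrightarrow>
      (\<Sum>y\<in>gball V E v0 R. (f y - mean (gball V E v0 R) f)\<^sup>2 * \<theta> y) \<le> C * (R\<^sup>2 * enn2real (energy V W f))"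
proof -
  define \<rho> \<rho>' where "\<rho> = 2 * q / (q + 1)" and "\<rho>' = 2 * p / (p - 1)"
  have \<rho>: "1 < \<rho>" "\<rho> < 2" "2 < \<rho>'"
    using pq by (auto simp: \<rho>_def \<rho>'_def field_simps)
  \<comment> \<open>The difference of d' / \<rho> and d' / \<rho>' is d' (1 / p + 1 / q) / 2, which
    is 1 by the definition of d'.\<close>
  have exponents: "d' / \<rho>' = d' / \<rho> - 1"
  proof -
    have "1 / p + 1 / q > 0" using pq by (simp add: add_pos_pos)
    then have "d' * (1 / p + 1 / q) = 2"
      by (intro iffD1[OF nonzero_eq_divide_eq d'(1)]) linarith
    moreover have "d' / \<rho>' = d' * (1 - 1 / p) / 2" "d' / \<rho> = d' * (1 + 1 / q) / 2"
      using pq by (simp_all add: \<rho>_def \<rho>'_def field_simps)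
    moreover have "x = y - 1" if "D * (u + v) = 2" "x = D * (1 - u) / 2" "y = D * (1 + v) / 2"
      for x y D u v :: real
      using that by (simp add: field_simps)
    ultimately show ?thesis by blast
  qed
  obtain C\<^sub>0 C\<^sub>S \<delta> where S: "C\<^sub>0 > 0" "C\<^sub>S > 0" "\<delta> \<ge> 1"
    and sob: "\<And>R r x f. R\<^sub>1 \<le> R \<Longrightarrow> C\<^sub>0 * R powr \<alpha>\<^sub>0 \<le> r \<Longrightarrow> r \<le> R \<Longrightarrow> x \<in> gball V E v0 R \<Longrightarrow>
          lp_norm \<rho>' (gball V E x r) (\<lambda>y. f y - mean (gball V E x r) f)
          \<le> C\<^sub>S * r powr (1 - d / d') *
             (\<Sum>(y, z) | y \<in> gball V E x (\<delta> * r) \<and> z \<in> gball V E x (\<delta> * r) \<and> (y, z) \<in> adj E.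
                \<bar>f y - f z\<bar> powr \<rho>) powr (1 / \<rho>)"
  proof -
    have "\<rho> < d'" "\<rho> < \<rho>'" using \<rho> d' by auto
    then show thesis
      using reg(2)[unfolded sobolev_regular_from_def, rule_format, of \<rho> \<rho>'] \<rho> exponents that by blast
  qed
  obtain c C where c: "c > 0" and C: "C > 0" and vol: "\<And>R r. R\<^sub>0 \<le> R \<Longrightarrow> R powr \<alpha>\<^sub>0 \<le> r \<Longrightarrow> r \<le> R \<Longrightarrow>
      c * r powr d \<le> real (card (gball V E v0 r)) \<and> real (card (gball V E v0 r)) \<le> C * r powr d"
  proof -
    show thesis by (rule volume_regular_centred[OF reg(1) infinite_graph_axioms base_vertex d(2)]) (fact that)
  qed
  have card_le: "real (card (gball V E v0 R)) \<le> C * R powr d" if "R \<ge> R\<^sub>0" for R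
  proof -
    have "R powr \<alpha>\<^sub>0 \<le> R powr 1" using that d by (intro powr_mono) auto
    then show ?thesis using vol[of R R] that d by auto
  qed
  obtain r' where r': "r' \<ge> 1" "\<And>R. R \<ge> r' \<Longrightarrow> R powr \<alpha>\<^sub>0 \<le> 1 / C\<^sub>0 * R"
    using powr_le_linear[OF \<open>\<alpha>\<^sub>0 < 1\<close>, of "1 / C\<^sub>0"] S by auto
  \<comment> \<open>The factors come from the moment of \<theta> on B(R), the Sobolev constant, the
    1/2 in the energy, and the moment of \<nu> on the dilated ball B(\<delta> R).\<close>
  define A where "A = (K\<^sub>p * C) powr (1 / p) * C\<^sub>S\<^sup>2 * 2 * (K\<^sub>q * (C * \<delta> powr d)) powr (1 / q)"
  show ?thesis
  proof (rule that[of A "max r' (max R\<^sub>0 R\<^sub>1)"])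
    fix R f assume R: "R \<ge> max r' (max R\<^sub>0 R\<^sub>1)" and fin: "energy V W f < \<infinity>"
    define e where "e = enn2real (energy V W f)"
    define B where "B = gball V E v0 R"
    define B' where "B' = gball V E v0 (\<delta> * R)"
    define G where "G = (\<Sum>(y, z) | y \<in> B' \<and> z \<in> B' \<and> (y, z) \<in> adj E. \<bar>f y - f z\<bar> powr \<rho>) powr (1 / \<rho>)"
    have R1: "R \<ge> 1" using R r' by simp
    \<comment> \<open>Dilation only increases the radius, so the volume and moment bounds hold on
      the larger ball too.\<close>
    have "R \<le> \<delta> * R" using R1 S by simp
    then have \<delta>R: "\<delta> * R \<ge> R\<^sub>0" "\<delta> * R \<ge> 1" using R R1 by linarith+
    have e0: "e \<ge> 0" by (simp add: e_def)
    have "C\<^sub>0 * R powr \<alpha>\<^sub>0 \<le> R" using r'(2)[of R] R S by (simp add: field_simps)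
    then have sob': "lp_norm \<rho>' B (\<lambda>y. f y - mean B f) \<le> C\<^sub>S * R powr (1 - d / d') * G"
      using sob[of R R v0 f] R centre_in_gball[OF base_vertex, of R] R1 by (simp add: B_def B'_def G_def)
    have nn: "0 \<le> lp_norm \<rho>' B (\<lambda>y. f y - mean B f)" by (simp add: lp_norm_def)
    have G: "G\<^sup>2 \<le> 2 * e * (\<Sum>y\<in>B'. nu E W y powr q) powr (1 / q)"
      unfolding G_def e_def B'_def
      by (rule gradient_norm_le_energy[OF pq(2) finite_gball[OF base_vertex] gball_subset fin \<rho>_def])
    have th: "(\<Sum>y\<in>B. \<theta> y powr p) powr (1 / p) \<le> (K\<^sub>p * C) powr (1 / p) * R powr (d / p)"
    proof -
      have "(\<Sum>y\<in>B. \<theta> y powr p) \<le> K\<^sub>p * (C * R powr d)"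
        unfolding B_def using K R by (intro order_trans[OF \<theta>p[OF R1]] mult_left_mono card_le) auto
      then have "(\<Sum>y\<in>B. \<theta> y powr p) powr (1 / p) \<le> (K\<^sub>p * (C * R powr d)) powr (1 / p)"
        using pq by (intro powr_mono2) (auto intro: sum_nonneg)
      then show ?thesis using K C by (simp add: powr_mult powr_powr mult.assoc)
    qed
    have nu': "(\<Sum>y\<in>B'. nu E W y powr q) powr (1 / q)
        \<le> (K\<^sub>q * (C * \<delta> powr d)) powr (1 / q) * R powr (d / q)"
    proof -
      have "(\<Sum>y\<in>B'. nu E W y powr q) \<le> K\<^sub>q * (C * (\<delta> * R) powr d)"
        unfolding B'_def using K by (intro order_trans[OF \<nu>q[OF \<delta>R(2)]] mult_left_mono card_le[OF \<delta>R(1)]) auto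
      then have "(\<Sum>y\<in>B'. nu E W y powr q) powr (1 / q) \<le> (K\<^sub>q * (C * (\<delta> * R) powr d)) powr (1 / q)"
        using pq by (intro powr_mono2) (auto intro: sum_nonneg)
      then show ?thesis using K C S R1 by (simp add: powr_mult powr_powr mult_ac)
    qed
    have "(\<Sum>y\<in>B. (f y - mean B f)\<^sup>2 * \<theta> y)
        \<le> (\<Sum>y\<in>B. \<theta> y powr p) powr (1 / p) * (lp_norm \<rho>' B (\<lambda>y. f y - mean B f))\<^sup>2"
      unfolding \<rho>'_def using pq theta_pos gball_subset
      by (intro weighted_square_sum_le_lp_norm) (auto simp: B_def gball_def less_imp_le)
    also have "\<dots> \<le> ((K\<^sub>p * C) powr (1 / p) * R powr (d / p)) * (C\<^sub>S * R powr (1 - d / d') * G)\<^sup>2"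
      using th sob' nn by (intro mult_mono power_mono) auto
    also have "\<dots> = (K\<^sub>p * C) powr (1 / p) * R powr (d / p) * (C\<^sub>S\<^sup>2 * (R powr (1 - d / d'))\<^sup>2) * G\<^sup>2"
      by (simp add: power_mult_distrib)
    also have "\<dots> \<le> (K\<^sub>p * C) powr (1 / p) * R powr (d / p) * (C\<^sub>S\<^sup>2 * (R powr (1 - d / d'))\<^sup>2) *
        (2 * e * ((K\<^sub>q * (C * \<delta> powr d)) powr (1 / q) * R powr (d / q)))"
      using e0 by (intro mult_left_mono order_trans[OF G] nu') auto
    also have "\<dots> = A * (R powr (d / p) * (R powr (1 - d / d'))\<^sup>2 * R powr (d / q) * e)"
      by (simp add: A_def)
    \<comment> \<open>The powers of R in the volume factors cancel those of the Sobolev constant,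
      since 2 d / d' = d / p + d / q.\<close>
    also have "R powr (d / p) * (R powr (1 - d / d'))\<^sup>2 * R powr (d / q) = R\<^sup>2"
    proof -
      have "2 * (1 - d / d') = 2 - d / p - d / q"
        unfolding d' by (simp add: algebra_simps)
      then have "d / p + 2 * (1 - d / d') + d / q = 2" by simp
      then have "R powr (d / p) * R powr (2 * (1 - d / d')) * R powr (d / q) = R powr 2"
        by (simp only: powr_add[symmetric])
      moreover have "(R powr (1 - d / d'))\<^sup>2 = R powr (2 * (1 - d / d'))"
        by (simp add: power2_eq_square flip: powr_add)
      ultimately show ?thesis using R1 by simp
    qed
    finally show "(\<Sum>y\<in>gball V E v0 R. (f y - mean (gball V E v0 R) f)\<^sup>2 * \<theta> y)
      \<le> A * (R\<^sup>2 * enn2real (energy V W f))" by (simp add: B_def e_def)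
  next
    show "A > 0" using K C S by (simp add: A_def)
    show "max r' (max R\<^sub>0 R\<^sub>1) \<ge> 1" using r' by simp
  qed
qed

end

section \<open>Estimate at a fixed scale\<close>

context conductance_graph
begin

text \<open>Chebyshev's argument: on F the factor (eta / r) powr m is at least 1, and the square of
  eta powr (m / 2) supplies that power of \<open>eta\<close>.\<close>

lemma sum_le_eta_moment:
  fixes f :: "'v \<Rightarrow> real"
  assumes fin: "(\<Sum>\<^sub>\<infinity>y\<in>V. ennreal (\<bar>real (eta E v0 y) powr (m / 2) * f y\<bar> powr 2 * \<theta> y)) < \<infinity>"
    and m: "m \<ge> 0" and r: "r > 0" and F: "finite F" "F \<subseteq> V" and eta: "\<And>y. y \<in> F \<Longrightarrow> r \<le> real (eta E v0 y)"
  shows "(\<Sum>y\<in>F. (f y)\<^sup>2 * \<theta> y) \<le> r powr (- m) *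
    enn2real (\<Sum>\<^sub>\<infinity>y\<in>V. ennreal (\<bar>real (eta E v0 y) powr (m / 2) * f y\<bar> powr 2 * \<theta> y))"
proof -
  have "(\<Sum>y\<in>F. (f y)\<^sup>2 * \<theta> y)
      \<le> (\<Sum>y\<in>F. r powr (- m) * (\<bar>real (eta E v0 y) powr (m / 2) * f y\<bar> powr 2 * \<theta> y))"
  proof (rule sum_mono)
    fix y assume y: "y \<in> F"
    have "r powr m \<le> real (eta E v0 y) powr m"
      using m r eta[OF y] by (intro powr_mono2) auto
    then have le: "r powr (- m) * r powr m * ((f y)\<^sup>2 * \<theta> y)
        \<le> r powr (- m) * real (eta E v0 y) powr m * ((f y)\<^sup>2 * \<theta> y)"
      using theta_pos[of y] y F by (intro mult_right_mono mult_left_mono) auto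
    have sq: "\<bar>real (eta E v0 y) powr (m / 2) * f y\<bar> powr 2 = real (eta E v0 y) powr m * (f y)\<^sup>2"
      by (simp add: power_mult_distrib power2_eq_square[of "_ powr _"] flip: powr_add)
    have "(f y)\<^sup>2 * \<theta> y = r powr (- m) * r powr m * ((f y)\<^sup>2 * \<theta> y)"
      using r by (simp flip: powr_add)
    also note le
    also have "r powr (- m) * real (eta E v0 y) powr m * ((f y)\<^sup>2 * \<theta> y)
        = r powr (- m) * (\<bar>real (eta E v0 y) powr (m / 2) * f y\<bar> powr 2 * \<theta> y)"
      by (subst sq) (simp only: mult_ac)
    finally show "(f y)\<^sup>2 * \<theta> y
        \<le> r powr (- m) * (\<bar>real (eta E v0 y) powr (m / 2) * f y\<bar> powr 2 * \<theta> y)" .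
  qed
  also have "\<dots> \<le> r powr (- m) *
    enn2real (\<Sum>\<^sub>\<infinity>y\<in>V. ennreal (\<bar>real (eta E v0 y) powr (m / 2) * f y\<bar> powr 2 * \<theta> y))"
    unfolding sum_distrib_left[symmetric]
    using theta_pos by (intro mult_left_mono finite_sum_le_enn2real_infsum[OF fin F]) (auto simp: less_imp_le)
  finally show ?thesis .
qed

text \<open>A finite sum is split at B(R). Outside the ball the weight gives the decay; inside, the
  oscillation is bounded by the Poincare inequality and the size on the annulus again by the weight.
  C and r are fixed before R, f and F.\<close>

lemma two_scale_estimate:
  assumes reg: "volume_regular V E v0 d R\<^sub>0 \<alpha>\<^sub>0" "sobolev_regular_from V E v0 d \<alpha>\<^sub>0 d' R\<^sub>1"
    and d: "d > 0" "R\<^sub>0 \<ge> 1" "\<alpha>\<^sub>0 < 1" and pq: "p > 1" "q > 1"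
    and d': "d' = 2 / (1 / p + 1 / q)" "2 \<le> d'" and m: "m \<ge> 0"
    and \<theta>p: "\<And>R. R \<ge> 1 \<Longrightarrow> (\<Sum>y\<in>gball V E v0 R. \<theta> y powr p) \<le> K\<^sub>p * real (card (gball V E v0 R))"
    and \<theta>1: "\<And>R. R \<ge> 1 \<Longrightarrow> (\<Sum>y\<in>gball V E v0 R. inverse (\<theta> y)) \<le> K' * real (card (gball V E v0 R))"
    and \<nu>q: "\<And>R. R \<ge> 1 \<Longrightarrow> (\<Sum>y\<in>gball V E v0 R. nu E W y powr q) \<le> K\<^sub>q * real (card (gball V E v0 R))"
    and K: "K\<^sub>p > 0" "K' > 0" "K\<^sub>q > 0"
  obtains C r where "C > 0" "r \<ge> 1"
    "\<And>R f F. R \<ge> r \<Longrightarrow> energy V W f < \<infinity> \<Longrightarrow>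
      (\<Sum>\<^sub>\<infinity>y\<in>V. ennreal (\<bar>real (eta E v0 y) powr (m / 2) * f y\<bar> powr 2 * \<theta> y)) < \<infinity> \<Longrightarrow>
      finite F \<Longrightarrow> F \<subseteq> V \<Longrightarrow>
      (\<Sum>y\<in>F. (f y)\<^sup>2 * \<theta> y) \<le> C * (R\<^sup>2 * enn2real (energy V W f) + R powr (- m) *
        enn2real (\<Sum>\<^sub>\<infinity>y\<in>V. ennreal (\<bar>real (eta E v0 y) powr (m / 2) * f y\<bar> powr 2 * \<theta> y)))"
proof -
  obtain C\<^sub>P r\<^sub>P where CP: "C\<^sub>P > 0" "r\<^sub>P \<ge> 1"
    and poincare: "\<And>R f. R \<ge> r\<^sub>P \<Longrightarrow> energy V W f < \<infinity> \<Longrightarrow>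
      (\<Sum>y\<in>gball V E v0 R. (f y - mean (gball V E v0 R) f)\<^sup>2 * \<theta> y) \<le> C\<^sub>P * (R\<^sup>2 * enn2real (energy V W f))"
  proof -
    show thesis by (rule weighted_poincare[OF reg d pq d']) fact+
  qed
  obtain \<kappa> L r\<^sub>A where \<kappa>: "0 < \<kappa>" "\<kappa> \<le> 1" and L: "L > 0" and rA: "r\<^sub>A \<ge> 1"
    and annulus: "\<And>R. R \<ge> r\<^sub>A \<Longrightarrow> real (card (gball V E v0 R))
      \<le> L * real (card (gball V E v0 R - gball V E v0 (\<kappa> * R)))"
  proof -
    show thesis
      by (rule annulus_volume[OF reg(1) infinite_graph_axioms base_vertex d(2,1,3)]) (fact that)
  qed
  \<comment> \<open>The moment \<open>1 + K\<^sub>p\<close> bounds the average of \<theta> itself,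
    because \<theta> \<le> 1 + \<theta> powr p.\<close>
  define C\<^sub>2 where "C\<^sub>2 = 2 + 4 * (1 + K\<^sub>p) * K' * L\<^sup>2"
  have C2: "C\<^sub>2 > 0" using K by (auto simp: C\<^sub>2_def intro!: add_pos_nonneg)
  \<comment> \<open>Dominates both the coefficient of the energy and that of the weighted norm; the
    summand 1 pays for the part outside the ball.\<close>
  define C where "C = C\<^sub>2 * C\<^sub>P + C\<^sub>2 * \<kappa> powr (- m) + 1"
  show ?thesis
  proof (rule that[of C "max r\<^sub>P r\<^sub>A"])
    show "C > 0" using C2 CP by (auto simp: C_def intro!: add_nonneg_pos)
    show "max r\<^sub>P r\<^sub>A \<ge> 1" using rA by simp
    fix R f F
    assume R: "R \<ge> max r\<^sub>P r\<^sub>A" and efin: "energy V W f < \<infinity>"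
      and nfin: "(\<Sum>\<^sub>\<infinity>y\<in>V. ennreal (\<bar>real (eta E v0 y) powr (m / 2) * f y\<bar> powr 2 * \<theta> y)) < \<infinity>"
      and F: "finite F" "F \<subseteq> V"
    define e where "e = enn2real (energy V W f)"
    define n where "n = enn2real (\<Sum>\<^sub>\<infinity>y\<in>V. ennreal (\<bar>real (eta E v0 y) powr (m / 2) * f y\<bar> powr 2 * \<theta> y))"
    have en: "e \<ge> 0" "n \<ge> 0" by (auto simp: e_def n_def)
    define B A where "B = gball V E v0 R" and "A = B - gball V E v0 (\<kappa> * R)"
    have R1: "R \<ge> 1" using R rA by simp
    have B: "finite B" "B \<subseteq> V" "v0 \<in> B"
      using finite_gball[OF base_vertex] gball_subset centre_in_gball[OF base_vertex] R1
      by (auto simp: B_def)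
    \<comment> \<open>Used twice: with s = \<kappa> R on the annulus and with s = R on F -
      B.\<close>
    have tail: "(\<Sum>y\<in>G. (f y)\<^sup>2 * \<theta> y) \<le> s powr (- m) * n"
      if "finite G" "G \<subseteq> V" "G \<inter> gball V E v0 s = {}" "s > 0" for G s
      unfolding n_def using that eta_outside_gball
      by (intro sum_le_eta_moment[OF nfin m]) blast+
    have cardA: "real (card B) \<le> L * real (card A)"
      using annulus[of R] R by (simp add: B_def A_def)
    have "card B > 0" using B by (auto simp: card_gt_0_iff)
    then have "A \<noteq> {}" using cardA by auto
    have \<theta>1': "(\<Sum>y\<in>B. \<theta> y) \<le> (1 + K\<^sub>p) * real (card B)"
    proof -
      have "(\<Sum>y\<in>B. \<theta> y) \<le> (\<Sum>y\<in>B. 1 + \<theta> y powr p)"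
      proof (rule sum_mono)
        fix y assume "y \<in> B"
        then have "\<theta> y > 0" using B theta_pos by blast
        then show "\<theta> y \<le> 1 + \<theta> y powr p"
          using powr_mono[of 1 p "\<theta> y"] pq by (cases "\<theta> y \<le> 1") (auto intro: order_trans add_increasing2)
      qed
      then show ?thesis using \<theta>p[OF R1] by (simp add: B_def sum.distrib algebra_simps)
    qed
    have "(\<Sum>y\<in>B. (f y)\<^sup>2 * \<theta> y) \<le> C\<^sub>2 *
        ((\<Sum>y\<in>B. (f y - mean B f)\<^sup>2 * \<theta> y) + (\<Sum>y\<in>A. (f y)\<^sup>2 * \<theta> y))"
      unfolding C\<^sub>2_def using B theta_pos \<theta>1[OF R1] \<theta>1' cardA \<open>A \<noteq> {}\<close>
      by (intro weighted_square_sum_le_oscillation) (auto simp: B_def A_def)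
    also have "\<dots> \<le> C\<^sub>2 * (C\<^sub>P * (R\<^sup>2 * e) + (\<kappa> * R) powr (- m) * n)"
    proof (intro mult_left_mono add_mono)
      show "(\<Sum>y\<in>B. (f y - mean B f)\<^sup>2 * \<theta> y) \<le> C\<^sub>P * (R\<^sup>2 * e)"
        unfolding B_def e_def using R efin by (intro poincare) auto
      show "(\<Sum>y\<in>A. (f y)\<^sup>2 * \<theta> y) \<le> (\<kappa> * R) powr (- m) * n"
        using B \<kappa> R1 by (intro tail) (auto simp: A_def)
    qed (use C2 in simp)
    also have "(\<kappa> * R) powr (- m) = \<kappa> powr (- m) * R powr (- m)"
      using \<kappa> R1 by (simp add: powr_mult)
    finally have inner: "(\<Sum>y\<in>B. (f y)\<^sup>2 * \<theta> y) \<le> C\<^sub>2 * (C\<^sub>P * (R\<^sup>2 * e) + \<kappa> powr (- m) * R powr (- m) * n)" .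
    have outer: "(\<Sum>y\<in>F - B. (f y)\<^sup>2 * \<theta> y) \<le> R powr (- m) * n"
      using F R1 by (intro tail) (auto simp: B_def)
    have "(\<Sum>y\<in>F. (f y)\<^sup>2 * \<theta> y) = (\<Sum>y\<in>F \<inter> B. (f y)\<^sup>2 * \<theta> y) + (\<Sum>y\<in>F - B. (f y)\<^sup>2 * \<theta> y)"
      using F(1) by (rule sum.Int_Diff)
    also have "(\<Sum>y\<in>F \<inter> B. (f y)\<^sup>2 * \<theta> y) \<le> (\<Sum>y\<in>B. (f y)\<^sup>2 * \<theta> y)"
    proof (rule sum_mono2)
      fix y assume "y \<in> B - F \<inter> B"
      then show "0 \<le> (f y)\<^sup>2 * \<theta> y" using B theta_pos[of y] by auto
    qed (use B in auto)
    finally have "(\<Sum>y\<in>F. (f y)\<^sup>2 * \<theta> y)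
        \<le> C\<^sub>2 * (C\<^sub>P * (R\<^sup>2 * e) + \<kappa> powr (- m) * R powr (- m) * n) + R powr (- m) * n"
      using inner outer by linarith
    also have "\<dots> = (C\<^sub>2 * C\<^sub>P) * (R\<^sup>2 * e) + (C\<^sub>2 * \<kappa> powr (- m) + 1) * (R powr (- m) * n)"
      by (simp add: algebra_simps)
    also have "\<dots> \<le> C * (R\<^sup>2 * e) + C * (R powr (- m) * n)"
      using en C2 CP by (intro add_mono mult_right_mono) (auto simp: C_def)
    finally show "(\<Sum>y\<in>F. (f y)\<^sup>2 * \<theta> y) \<le> C * (R\<^sup>2 * enn2real (energy V W f) + R powr (- m) *
        enn2real (\<Sum>\<^sub>\<infinity>y\<in>V. ennreal (\<bar>real (eta E v0 y) powr (m / 2) * f y\<bar> powr 2 * \<theta> y)))"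
      by (simp add: e_def n_def algebra_simps)
  qed
qed

text \<open>At R = 1 the last term alone averages a function that is at least 1. Hence multiplying a
  right-hand side by this constant does not decrease it.\<close>

lemma one_le_moment_const: "1 \<le> moment_const V E v0 \<theta> W p q"
proof -
  define B where "B = gball V E v0 1"
  have B: "finite B" "v0 \<in> B"
    using finite_gball[OF base_vertex] centre_in_gball[OF base_vertex] by (auto simp: B_def)
  have nonneg: "0 \<le> avg_norm r B (\<lambda>y. max 1 (g y))" for r g
  proof -
    have "0 \<le> Max ((\<lambda>y. \<bar>max 1 (g y)\<bar>) ` B)"
      using B Max_ge[of "(\<lambda>y. \<bar>max 1 (g y)\<bar>) ` B" "\<bar>max 1 (g v0)\<bar>"] by force
    then show ?thesis by (simp add: avg_norm_def)
  qed
  have "real (card B) = (\<Sum>y\<in>B. 1)" by simp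
  also have "\<dots> \<le> (\<Sum>y\<in>B. \<bar>max 1 (inverse (\<theta> y))\<bar>)" by (rule sum_mono) auto
  finally have "1 \<le> mean B (\<lambda>y. \<bar>max 1 (inverse (\<theta> y))\<bar>)"
    using B by (auto simp: mean_def le_divide_eq card_gt_0_iff)
  then have "1 \<le> avg_norm 1 B (\<lambda>y. max 1 (inverse (\<theta> y)))"
    by (simp add: avg_norm_def one_ereal_def)
  then have "1 \<le> avg_norm p B (\<lambda>y. max 1 (\<theta> y)) * avg_norm q B (\<lambda>y. max 1 (nu E W y)) +
        avg_norm 1 B (\<lambda>y. max 1 (inverse (\<theta> y)))"
    using nonneg by (intro add_increasing mult_nonneg_nonneg) auto
  then have "1 \<le> ennreal (avg_norm p B (\<lambda>y. max 1 (\<theta> y)) * avg_norm q B (\<lambda>y. max 1 (nu E W y)) +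
        avg_norm 1 B (\<lambda>y. max 1 (inverse (\<theta> y))))"
    by simp
  also have "\<dots> \<le> moment_const V E v0 \<theta> W p q"
    unfolding moment_const_def B_def by (rule SUP_upper) simp
  finally show ?thesis .
qed

end

section \<open>Finite exponents and the interpolation inequality\<close>

text \<open>Turns the suprema of norms into bounds on sums with real exponents. The strict
  inequality for 1 / p + 1 / q leaves room to lower infinite exponents.\<close>

lemma moment_sum_bounds:
  assumes graph: "conductance_graph V E v\<^sub>0 \<theta> W" and p: "1 < p" and q: "1 < q"
    and fin: "moment_sum V E v\<^sub>0 \<theta> W p q < \<infinity>" and s: "1 / p + 1 / q < ereal s"
  obtains p' q' K\<^sub>p K\<^sub>q K' :: real where "p' > 1" "q' > 1" "1 / p' + 1 / q' < s"
    "K\<^sub>p > 0" "K\<^sub>q > 0" "K' > 0"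
    "\<And>R. R \<ge> 1 \<Longrightarrow> (\<Sum>y\<in>gball V E v\<^sub>0 R. \<theta> y powr p') \<le> K\<^sub>p * real (card (gball V E v\<^sub>0 R))"
    "\<And>R. R \<ge> 1 \<Longrightarrow> (\<Sum>y\<in>gball V E v\<^sub>0 R. nu E W y powr q') \<le> K\<^sub>q * real (card (gball V E v\<^sub>0 R))"
    "\<And>R. R \<ge> 1 \<Longrightarrow> (\<Sum>y\<in>gball V E v\<^sub>0 R. inverse (\<theta> y)) \<le> K' * real (card (gball V E v\<^sub>0 R))"
proof -
  interpret conductance_graph V E v\<^sub>0 \<theta> W by fact
  have B: "finite (gball V E v\<^sub>0 R)" for R by (rule finite_gball[OF base_vertex])
  have pos: "\<bar>\<theta> y\<bar> = \<theta> y" "\<bar>nu E W y\<bar> = nu E W y" if "y \<in> gball V E v\<^sub>0 R" for y R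
    using that gball_subset theta_pos W_pos
    by (auto simp: nu_def gball_def less_imp_le intro!: sum_nonneg abs_of_nonneg)
  have sups: "(SUP R\<in>{1::real..}. ennreal (avg_norm p (gball V E v\<^sub>0 R) \<theta>)) < \<infinity>"
    "(SUP R\<in>{1::real..}. ennreal (avg_norm 1 (gball V E v\<^sub>0 R) (\<lambda>y. inverse (\<theta> y)))) < \<infinity>"
    "(SUP R\<in>{1::real..}. ennreal (avg_norm q (gball V E v\<^sub>0 R) (nu E W))) < \<infinity>"
    using fin by (simp_all add: moment_sum_def less_top)
  define ip iq where "ip = real_of_ereal (1 / p)" and "iq = real_of_ereal (1 / q)"
  \<comment> \<open>A third of the gap: raising both reciprocals by at most \<epsilon> uses two
    thirds and keeps the inequality strict.\<close>
  define \<epsilon> where "\<epsilon> = (s - (ip + iq)) / 3"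
  have "ip + iq < s"
    using s p q by (cases p; cases q) (auto simp: ip_def iq_def one_ereal_def)
  then have \<epsilon>: "\<epsilon> > 0" by (simp add: \<epsilon>_def)
  obtain p' K\<^sub>p where p': "p' > 1" "1 / p' \<le> ip + \<epsilon>" "K\<^sub>p > 0"
    "\<And>R. R \<in> {1..} \<Longrightarrow> (\<Sum>y\<in>gball V E v\<^sub>0 R. \<bar>\<theta> y\<bar> powr p') \<le> K\<^sub>p * real (card (gball V E v\<^sub>0 R))"
  proof -
    show thesis by (rule finite_moment[OF p \<epsilon> B sups(1), folded ip_def]) (fact that)
  qed
  obtain q' K\<^sub>q where q': "q' > 1" "1 / q' \<le> iq + \<epsilon>" "K\<^sub>q > 0"
    "\<And>R. R \<in> {1..} \<Longrightarrow> (\<Sum>y\<in>gball V E v\<^sub>0 R. \<bar>nu E W y\<bar> powr q') \<le> K\<^sub>q * real (card (gball V E v\<^sub>0 R))"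
  proof -
    show thesis by (rule finite_moment[OF q \<epsilon> B sups(3), folded iq_def]) (fact that)
  qed
  obtain K' where K': "K' > 0"
    "\<And>R. R \<in> {1..} \<Longrightarrow> avg_norm 1 (gball V E v\<^sub>0 R) (\<lambda>y. inverse (\<theta> y)) \<le> K'"
    using sups(2) by (rule SUP_ennreal_finite_bound) blast
  show ?thesis
  proof (rule that[of p' q' K\<^sub>p K\<^sub>q K'])
    have "3 * \<epsilon> = s - (ip + iq)" by (simp add: \<epsilon>_def)
    then show "1 / p' + 1 / q' < s" using p'(2) q'(2) \<epsilon> by linarith
    fix R :: real assume R: "R \<ge> 1"
    show "(\<Sum>y\<in>gball V E v\<^sub>0 R. \<theta> y powr p') \<le> K\<^sub>p * real (card (gball V E v\<^sub>0 R))"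
      using p'(4)[of R] R pos by (simp cong: sum.cong)
    show "(\<Sum>y\<in>gball V E v\<^sub>0 R. nu E W y powr q') \<le> K\<^sub>q * real (card (gball V E v\<^sub>0 R))"
      using q'(4)[of R] R pos by (simp cong: sum.cong)
    have "mean (gball V E v\<^sub>0 R) (\<lambda>y. \<bar>inverse (\<theta> y)\<bar>) \<le> K'"
      using K'(2)[of R] R by (simp add: avg_norm_def one_ereal_def mean_def sum_nonneg)
    moreover have "card (gball V E v\<^sub>0 R) > 0"
      using centre_in_gball[OF base_vertex, of R] R B by (auto simp: card_gt_0_iff)
    ultimately show "(\<Sum>y\<in>gball V E v\<^sub>0 R. inverse (\<theta> y)) \<le> K' * real (card (gball V E v\<^sub>0 R))"
      using pos by (simp add: mean_def divide_le_eq cong: sum.cong)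
  qed (use p' q' K' in auto)
qed

text \<open>The two products agree on finite factors, and otherwise \<open>\<odot>\<close> is
  infinite.\<close>

lemma le_top_multI: "x \<le> a \<Longrightarrow> y \<le> b \<Longrightarrow> x * y \<le> a \<odot> b"
  by (simp add: top_mult_def mult_mono)

theorem theorem1p3:
  fixes V :: "'v set" and E :: "'v set set" and v0 :: 'v
    and \<theta> :: "'v \<Rightarrow> real" and W :: "'v \<Rightarrow> 'v \<Rightarrow> real"
    and d R\<^sub>0 \<alpha>\<^sub>0 :: real and R\<^sub>1 :: "real \<Rightarrow> real" and p q :: ereal
  assumes "conductance_graph V E v0 \<theta> W"
    and "d \<ge> 2" and "R\<^sub>0 \<ge> 1" and "0 \<le> \<alpha>\<^sub>0" and "\<alpha>\<^sub>0 < 1 / 2"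
    and "large_scale_regular V E v0 d R\<^sub>0 \<alpha>\<^sub>0 R\<^sub>1"
    and "1 < p" and "1 < q" and "1 / p + 1 / q < ereal (2 / d)"
    and "moment_sum V E v0 \<theta> W p q < \<infinity>"
  shows "\<forall>m::real. m \<ge> 2 \<longrightarrow> (\<exists>d' > d. \<exists>C\<^sub>1 > 0. \<forall>f :: 'v \<Rightarrow> real.
    (weighted_lp_norm 2 V \<theta> f)\<^sup>2 \<le>
      ennreal C\<^sub>1 \<odot> ennreal (R\<^sub>1 d' powr m) \<odot> moment_const V E v0 \<theta> W p q
        \<odot> ennreal_powr (energy V W f) (m / (m + 2))
        \<odot> ennreal_powr (weighted_lp_norm 2 V \<theta> (\<lambda>y. real (eta E v0 y) powr (m / 2) * f y))
            (4 / (m + 2)))"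
proof (intro allI impI)
  fix m :: real assume m: "m \<ge> 2"
  interpret conductance_graph V E v0 \<theta> W by fact
  obtain p' q' K\<^sub>p K\<^sub>q K' :: real where pq: "p' > 1" "q' > 1" "1 / p' + 1 / q' < 2 / d"
    and K: "K\<^sub>p > 0" "K\<^sub>q > 0" "K' > 0"
    and moments: "\<And>R. R \<ge> 1 \<Longrightarrow> (\<Sum>y\<in>gball V E v0 R. \<theta> y powr p') \<le> K\<^sub>p * real (card (gball V E v0 R))"
    "\<And>R. R \<ge> 1 \<Longrightarrow> (\<Sum>y\<in>gball V E v0 R. nu E W y powr q') \<le> K\<^sub>q * real (card (gball V E v0 R))"
    "\<And>R. R \<ge> 1 \<Longrightarrow> (\<Sum>y\<in>gball V E v0 R. inverse (\<theta> y)) \<le> K' * real (card (gball V E v0 R))"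
  proof -
    show thesis by (rule moment_sum_bounds[OF assms(1,7,8,10,9)]) (fact that)
  qed
  \<comment> \<open>Chosen so that 2 / d' = 1 / p' + 1 / q'; the strict bound by 2 / d is then
    equivalent to d' > d.\<close>
  define d' where "d' = 2 / (1 / p' + 1 / q')"
  have "1 / p' + 1 / q' > 0" using pq by (simp add: add_pos_pos)
  then have d': "d < d'" using pq(3) \<open>d \<ge> 2\<close> by (simp add: d'_def less_divide_eq mult.commute)
  have reg: "volume_regular V E v0 d R\<^sub>0 \<alpha>\<^sub>0" "sobolev_regular_from V E v0 d \<alpha>\<^sub>0 d' (R\<^sub>1 d')" "R\<^sub>0 \<le> R\<^sub>1 d'"
    using assms(6) d' by (auto simp: large_scale_regular_def)
  obtain C r where Cr: "C > 0" "r \<ge> 1"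
    and scale: "\<And>R f F. R \<ge> r \<Longrightarrow> energy V W f < \<infinity> \<Longrightarrow>
      (\<Sum>\<^sub>\<infinity>y\<in>V. ennreal (\<bar>real (eta E v0 y) powr (m / 2) * f y\<bar> powr 2 * \<theta> y)) < \<infinity> \<Longrightarrow>
      finite F \<Longrightarrow> F \<subseteq> V \<Longrightarrow>
      (\<Sum>y\<in>F. (f y)\<^sup>2 * \<theta> y) \<le> C * (R\<^sup>2 * enn2real (energy V W f) + R powr (- m) *
        enn2real (\<Sum>\<^sub>\<infinity>y\<in>V. ennreal (\<bar>real (eta E v0 y) powr (m / 2) * f y\<bar> powr 2 * \<theta> y)))"
  proof -
    have "d > 0" "\<alpha>\<^sub>0 < 1" "2 \<le> d'" "m \<ge> 0" using assms d' m by auto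
    note bounds = this
    show thesis
      by (rule two_scale_estimate[OF reg(1,2) bounds(1) \<open>R\<^sub>0 \<ge> 1\<close> bounds(2) pq(1,2) d'_def bounds(3,4)])
        fact+
  qed
  \<comment> \<open>The constant produced by \<open>optimize_scale\<close>; it depends on m but not
    on f.\<close>
  define C\<^sub>1 where "C\<^sub>1 = 2 * C + r powr m"
  have C1: "C\<^sub>1 > 0" using Cr by (simp add: C\<^sub>1_def add_pos_nonneg)
  have "(weighted_lp_norm 2 V \<theta> f)\<^sup>2 \<le>
      ennreal C\<^sub>1 \<odot> ennreal (R\<^sub>1 d' powr m) \<odot> moment_const V E v0 \<theta> W p q
        \<odot> ennreal_powr (energy V W f) (m / (m + 2))
        \<odot> ennreal_powr (weighted_lp_norm 2 V \<theta> (\<lambda>y. real (eta E v0 y) powr (m / 2) * f y))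
            (4 / (m + 2))" (is "_ \<le> _ \<odot> _ \<odot> _ \<odot> ?P \<odot> ?Q") for f
  proof -
    define N where "N = (\<Sum>\<^sub>\<infinity>y\<in>V. ennreal (\<bar>real (eta E v0 y) powr (m / 2) * f y\<bar> powr 2 * \<theta> y))"
    define S where "S = (\<Sum>\<^sub>\<infinity>y\<in>V. ennreal (\<bar>f y\<bar> powr 2 * \<theta> y))"
    show ?thesis
    proof (cases "energy V W f < \<infinity> \<and> N < \<infinity>")
      \<comment> \<open>An infinite energy or weighted norm makes the right-hand side infinite, even
        if another factor is 0, by the convention in \<open>\<odot>\<close>.\<close>
      case False
      then have "?P = \<infinity> \<or> ?Q = \<infinity>"
        by (auto simp: weighted_lp_norm_def N_def ennreal_powr_def less_top[symmetric])
      then show ?thesis by (auto simp: top_mult_def)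
    next
      case True
      define e n where "e = enn2real (energy V W f)" and "n = enn2real N"
      have en: "e \<ge> 0" "n \<ge> 0" by (auto simp: e_def n_def)
      define b where "b = C\<^sub>1 * (e powr (m / (m + 2)) * n powr (2 / (m + 2)))"
      have b: "b \<ge> 0" using C1 by (simp add: b_def)
      \<comment> \<open>Only finite partial sums are estimated, so finiteness of S is a consequence
        here.\<close>
      have "S \<le> ennreal b" unfolding S_def
      proof (rule infsum_ennreal_leI)
        fix F assume F: "finite F" "F \<subseteq> V"
        \<comment> \<open>As \<open>eta\<close> is at least 1 everywhere, the radius 1 gives the
          crude bound by n that \<open>optimize_scale\<close> uses below its threshold.\<close>
        have "(\<Sum>y\<in>F. (f y)\<^sup>2 * \<theta> y) \<le> 1 powr (- m) * n"
          unfolding n_def N_def using True m F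
          by (intro sum_le_eta_moment) (auto simp: N_def eta_def)
        then have "(\<Sum>y\<in>F. (f y)\<^sup>2 * \<theta> y) \<le> b"
          unfolding b_def C\<^sub>1_def using scale[of _ f F] True F m Cr en
          by (intro optimize_scale) (auto simp: e_def n_def N_def)
        moreover have "(\<Sum>y\<in>F. ennreal (\<bar>f y\<bar> powr 2 * \<theta> y)) = ennreal (\<Sum>y\<in>F. (f y)\<^sup>2 * \<theta> y)"
          using F theta_pos by (subst sum_ennreal) (auto simp: subset_iff less_imp_le)
        ultimately show "(\<Sum>y\<in>F. ennreal (\<bar>f y\<bar> powr 2 * \<theta> y)) \<le> ennreal b"
          by (simp add: ennreal_leI)
      qed
      then have "S < \<infinity>" using le_less_trans ennreal_less_top by fastforce
      have "(weighted_lp_norm 2 V \<theta> f)\<^sup>2 = ennreal ((enn2real S powr (1 / 2))\<^sup>2)"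
        using \<open>S < \<infinity>\<close> by (simp add: weighted_lp_norm_def S_def ennreal_powr_def ennreal_power)
      also have "\<dots> = S"
        using \<open>S < \<infinity>\<close> by (simp add: powr_half_sqrt)
      \<comment> \<open>The two factors 1 hold the places of \<open>R\<^sub>1 d' powr m\<close> and
        \<open>moment_const\<close>, which are both at least 1.\<close>
      also have "\<dots> \<le> ennreal C\<^sub>1 * 1 * 1 * ?P * ?Q"
      proof -
        have "?P = ennreal (e powr (m / (m + 2)))"
          using True by (simp add: ennreal_powr_def e_def less_top)
        \<comment> \<open>The norm is the square root of N, which halves the exponent 4 / (m +
          2).\<close>
        moreover have "?Q = ennreal (n powr (2 / (m + 2)))"
          using True by (simp add: weighted_lp_norm_def ennreal_powr_def n_def N_def powr_powr less_top)
        ultimately have "ennreal b = ennreal C\<^sub>1 * 1 * 1 * ?P * ?Q"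
          using C1 by (simp add: b_def ennreal_mult mult_ac)
        then show ?thesis using \<open>S \<le> ennreal b\<close> by simp
      qed
      also have "\<dots> \<le> ennreal C\<^sub>1 \<odot> ennreal (R\<^sub>1 d' powr m) \<odot> moment_const V E v0 \<theta> W p q \<odot> ?P \<odot> ?Q"
      proof -
        have "1 \<le> R\<^sub>1 d' powr m" using reg(3) \<open>R\<^sub>0 \<ge> 1\<close> m by (intro ge_one_powr_ge_zero) auto
        then show ?thesis
          by (intro le_top_multI one_le_moment_const order_refl) simp
      qed
      finally show ?thesis .
    qed
  qed
  then show "\<exists>d' > d. \<exists>C\<^sub>1 > 0. \<forall>f :: 'v \<Rightarrow> real.
    (weighted_lp_norm 2 V \<theta> f)\<^sup>2 \<le>
      ennreal C\<^sub>1 \<odot> ennreal (R\<^sub>1 d' powr m) \<odot> moment_const V E v0 \<theta> W p q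
        \<odot> ennreal_powr (energy V W f) (m / (m + 2))
        \<odot> ennreal_powr (weighted_lp_norm 2 V \<theta> (\<lambda>y. real (eta E v0 y) powr (m / 2) * f y))
            (4 / (m + 2))"
    using d' C1 by blast
qed

end
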